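(* Let $\Omega_8=\mathbb{Z}\omega_0+\mathbb{Z}\omega_1+\cdots+\mathbb{Z}\omega_7\subset\mathbb{O}$ with $\omega_0=1$ and $\omega_0,\dots,\omega_7$ $\mathbb{R}$-linearly independent. Let $\lambda\in\mathbb{O}\setminus\mathbb{R}$ with $\lambda\Omega_8\subseteq\Omega_8$ and $\mu\in\mathbb{O}\setminus\mathbb{R}$ with $\Omega_8\mu\subseteq\Omega_8$, and let $n_{h_j}\in\mathbb{Z}$ be the integers with $\lambda\cdot(\omega_h\mu)=\sum_{j=0}^7 n_{h_j}\omega_j$ ($h=0,\dots,7$). Let ${\cal{V}}_{\lambda,\mu;\Omega}=\{v\in{\cal{F}}\mid v=(\lambda^{-1}\omega)\cdot\mu^{-1},\ \omega\in\Omega_8\}$. Then for each $i=1,\dots,7$, $$\sum_{v\in{\cal{V}}_{\lambda,\mu;\Omega}\setminus\{0\}}\wp_{\tau(i)}(v)=-\frac{({\cal{N}}(\lambda){\cal{N}}(\mu))^3}{\det(W)}\Bigg[\sum_{h=0}^7\Theta_{h_i}\Big(\big(\mu\cdot\big(\textstyle\sum_{j=0}^7 n_{h_j}\eta_j\big)\big)\cdot\lambda\Big)-{\cal{N}}(\lambda){\cal{N}}(\mu)\sum_{h=0}^7\Theta_{h_i}\eta_h\Bigg].$$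
   Context: $\mathbb{O}$ denotes the real octonions with basis $e_0=1,e_1,\dots,e_7$, elements $z=x_0+\sum_{j=1}^7x_je_j$, conjugation $\overline z=x_0-\sum_jx_je_j$, norm ${\cal{N}}(z)=z\overline z=|z|^2$; parentheses indicate the order of the non-associative multiplications. Write $\omega_h=\sum_{j=0}^7\omega_{h_j}e_j$ with real $\omega_{h_j}$, let $W=(\omega_{h_j})_{h,j=0}^7$, and let $\Theta_{h_j}$ be the cofactor (adjoint determinant) of the entry $\omega_{h_j}$, so that $\sum_{h=0}^7\omega_{h_i}\Theta_{h_l}=\delta_{il}\det(W)$. The fundamental cell is ${\cal{F}}=\{\alpha_0\omega_0+\cdots+\alpha_7\omega_7\mid 0\le\alpha_j<1\}$. Let $q_{\bf 0}(z)=\overline z/|z|^8$, $q_{\tau(j)}=\frac{\partial}{\partial x_j}q_{\bf 0}$, and $V_{\tau(j)}(z)=x_j-x_0e_j$ ($j=1,\dots,7$). Define $$\wp_{\tau(i)}(z)=q_{\tau(i)}(z)+\sum_{\omega\in\Omega_8\setminus\{0\}}\big(q_{\tau(i)}(z+\omega)-q_{\tau(i)}(\omega)\big),$$ $$\zeta(z)=q_{\bf 0}(z)+\sum_{\omega\in\Omega_8\setminus\{0\}}\Big(q_{\bf 0}(z+\omega)-q_{\bf 0}(\omega)+\sum_{j=1}^7V_{\tau(j)}(z)\,q_{\tau(j)}(\omega)\Big).$$ $\zeta$ is quasi-periodic: for each $h=0,\dots,7$ there is an octonionic constant $\eta_h$ (the octonionic Legendre constant) with $\zeta(z+\omega_h)-\zeta(z)=\eta_h$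 for all $z$ off the lattice.
   Formalization: In ζ the linear term ΣV_{τ(j)}(z)q_{τ(j)}(ω) is subtracted, not added (else the series diverges), and (μ·(Σ n_{h_j}η_j))·λ is replaced by μ·((Σ n_{h_j}η_j)·λ), as the printed bracketing fails for Ω=⊕ℤe_j, λ=e_1, μ=e_2, i=3. *)

theory Defs
  imports "HOL-Analysis.Analysis"
begin

section \<open>Octonions\<close>

text \<open>
  An octonion is the vector of its coordinates \<open>x\<^sub>0, \<dots>, x\<^sub>7\<close> with respect to the basis
  \<open>e\<^sub>0 = 1, e\<^sub>1, \<dots>, e\<^sub>7\<close>. The index type \<^typ>\<open>8\<close> consists of the residues \<open>0, \<dots>, 7\<close>, so
  an index of type \<^typ>\<open>8\<close> different from \<open>0\<close> is one of \<open>1, \<dots>, 7\<close>. Addition, real scaling,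
  norm and topology are those of the Euclidean space; the componentwise product that the
  library puts on this type is not the octonion product and is not used.
\<close>

type_synonym octonion = "real^8"

definition oct_e :: "8 \<Rightarrow> octonion" where
  "oct_e j = axis j 1"

definition oct_of_real :: "real \<Rightarrow> octonion" where
  "oct_of_real r = r *\<^sub>R oct_e 0"

definition oct_conj :: "octonion \<Rightarrow> octonion" where
  "oct_conj z = (\<chi> j. if j = 0 then z $ 0 else - z $ j)"

text \<open>
  The multiplication table is the one determined by \<open>e\<^sub>4 = e\<^sub>1e\<^sub>2\<close>, \<open>e\<^sub>5 = e\<^sub>1e\<^sub>3\<close>, \<open>e\<^sub>6 = e\<^sub>2e\<^sub>3\<close>,
  \<open>e\<^sub>7 = e\<^sub>4e\<^sub>3 = (e\<^sub>1e\<^sub>2)e\<^sub>3\<close>. The operator is declared without associativity, so that nested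
  products have to be bracketed.
\<close>

definition oct_mult :: "octonion \<Rightarrow> octonion \<Rightarrow> octonion" (infix "\<odot>" 70) where
  "x \<odot> y = (\<chi> k.
     if k = 0 then x $ 0 * y $ 0 - x $ 1 * y $ 1 - x $ 2 * y $ 2 - x $ 3 * y $ 3 - x $ 4 * y $ 4 - x $ 5 * y $ 5 - x $ 6 * y $ 6 - x $ 7 * y $ 7 else
     if k = 1 then x $ 0 * y $ 1 + x $ 1 * y $ 0 + x $ 2 * y $ 4 + x $ 3 * y $ 5 - x $ 4 * y $ 2 - x $ 5 * y $ 3 - x $ 6 * y $ 7 + x $ 7 * y $ 6 else
     if k = 2 then x $ 0 * y $ 2 - x $ 1 * y $ 4 + x $ 2 * y $ 0 + x $ 3 * y $ 6 + x $ 4 * y $ 1 + x $ 5 * y $ 7 - x $ 6 * y $ 3 - x $ 7 * y $ 5 else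
     if k = 3 then x $ 0 * y $ 3 - x $ 1 * y $ 5 - x $ 2 * y $ 6 + x $ 3 * y $ 0 - x $ 4 * y $ 7 + x $ 5 * y $ 1 + x $ 6 * y $ 2 + x $ 7 * y $ 4 else
     if k = 4 then x $ 0 * y $ 4 + x $ 1 * y $ 2 - x $ 2 * y $ 1 + x $ 3 * y $ 7 + x $ 4 * y $ 0 - x $ 5 * y $ 6 + x $ 6 * y $ 5 - x $ 7 * y $ 3 else
     if k = 5 then x $ 0 * y $ 5 + x $ 1 * y $ 3 - x $ 2 * y $ 7 - x $ 3 * y $ 1 + x $ 4 * y $ 6 + x $ 5 * y $ 0 - x $ 6 * y $ 4 + x $ 7 * y $ 2 else
     if k = 6 then x $ 0 * y $ 6 + x $ 1 * y $ 7 + x $ 2 * y $ 3 - x $ 3 * y $ 2 - x $ 4 * y $ 5 + x $ 5 * y $ 4 + x $ 6 * y $ 0 - x $ 7 * y $ 1 else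
     x $ 0 * y $ 7 - x $ 1 * y $ 6 + x $ 2 * y $ 5 - x $ 3 * y $ 4 + x $ 4 * y $ 3 - x $ 5 * y $ 2 + x $ 6 * y $ 1 + x $ 7 * y $ 0)"

definition oct_N :: "octonion \<Rightarrow> real" where
  "oct_N z = (norm z)\<^sup>2"

definition oct_inverse :: "octonion \<Rightarrow> octonion" where
  "oct_inverse z = (1 / oct_N z) *\<^sub>R oct_conj z"

lemma exhaust_8:
  fixes k :: 8
  shows "k = 0 \<or> k = 1 \<or> k = 2 \<or> k = 3 \<or> k = 4 \<or> k = 5 \<or> k = 6 \<or> k = 7"
proof (induct k)
  case (of_int z)
  then have "z = 0 \<or> z = 1 \<or> z = 2 \<or> z = 3 \<or> z = 4 \<or> z = 5 \<or> z = 6 \<or> z = 7" by simp presburger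
  then show ?case by (elim disjE) simp_all
qed

lemma forall_8:
  "(\<forall>k::8. P k) \<longleftrightarrow> P 0 \<and> P 1 \<and> P 2 \<and> P 3 \<and> P 4 \<and> P 5 \<and> P 6 \<and> P 7"
  by (metis exhaust_8)

lemma UNIV_8: "UNIV = {0, 1, 2, 3, 4, 5, 6, 7::8}"
  using exhaust_8 by auto

lemma sum_8: "sum f (UNIV::8 set) = f 0 + f 1 + f 2 + f 3 + f 4 + f 5 + f 6 + f 7"
  unfolding UNIV_8 by (simp add: ac_simps)

lemma oct_N_sum:
  "oct_N z = (z$0)\<^sup>2 + (z$1)\<^sup>2 + (z$2)\<^sup>2 + (z$3)\<^sup>2 + (z$4)\<^sup>2 + (z$5)\<^sup>2 + (z$6)\<^sup>2 + (z$7)\<^sup>2"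
  unfolding oct_N_def power2_norm_eq_inner inner_vec_def sum_8
  by (simp add: power2_eq_square)

lemma oct_mult_nth:
  "(x \<odot> y) $ 0 = x $ 0 * y $ 0 - x $ 1 * y $ 1 - x $ 2 * y $ 2 - x $ 3 * y $ 3 - x $ 4 * y $ 4 - x $ 5 * y $ 5 - x $ 6 * y $ 6 - x $ 7 * y $ 7"
  "(x \<odot> y) $ 1 = x $ 0 * y $ 1 + x $ 1 * y $ 0 + x $ 2 * y $ 4 + x $ 3 * y $ 5 - x $ 4 * y $ 2 - x $ 5 * y $ 3 - x $ 6 * y $ 7 + x $ 7 * y $ 6"
  "(x \<odot> y) $ 2 = x $ 0 * y $ 2 - x $ 1 * y $ 4 + x $ 2 * y $ 0 + x $ 3 * y $ 6 + x $ 4 * y $ 1 + x $ 5 * y $ 7 - x $ 6 * y $ 3 - x $ 7 * y $ 5"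
  "(x \<odot> y) $ 3 = x $ 0 * y $ 3 - x $ 1 * y $ 5 - x $ 2 * y $ 6 + x $ 3 * y $ 0 - x $ 4 * y $ 7 + x $ 5 * y $ 1 + x $ 6 * y $ 2 + x $ 7 * y $ 4"
  "(x \<odot> y) $ 4 = x $ 0 * y $ 4 + x $ 1 * y $ 2 - x $ 2 * y $ 1 + x $ 3 * y $ 7 + x $ 4 * y $ 0 - x $ 5 * y $ 6 + x $ 6 * y $ 5 - x $ 7 * y $ 3"
  "(x \<odot> y) $ 5 = x $ 0 * y $ 5 + x $ 1 * y $ 3 - x $ 2 * y $ 7 - x $ 3 * y $ 1 + x $ 4 * y $ 6 + x $ 5 * y $ 0 - x $ 6 * y $ 4 + x $ 7 * y $ 2"
  "(x \<odot> y) $ 6 = x $ 0 * y $ 6 + x $ 1 * y $ 7 + x $ 2 * y $ 3 - x $ 3 * y $ 2 - x $ 4 * y $ 5 + x $ 5 * y $ 4 + x $ 6 * y $ 0 - x $ 7 * y $ 1"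
  "(x \<odot> y) $ 7 = x $ 0 * y $ 7 - x $ 1 * y $ 6 + x $ 2 * y $ 5 - x $ 3 * y $ 4 + x $ 4 * y $ 3 - x $ 5 * y $ 2 + x $ 6 * y $ 1 + x $ 7 * y $ 0"
  by (simp_all add: oct_mult_def)

lemma oct_conj_nth:
  "oct_conj z $ 0 = z $ 0"
  "oct_conj z $ 1 = - z $ 1"
  "oct_conj z $ 2 = - z $ 2"
  "oct_conj z $ 3 = - z $ 3"
  "oct_conj z $ 4 = - z $ 4"
  "oct_conj z $ 5 = - z $ 5"
  "oct_conj z $ 6 = - z $ 6"
  "oct_conj z $ 7 = - z $ 7"
  by (simp_all add: oct_conj_def)

lemmas oct_component_simps =
  oct_mult_def oct_conj_def oct_of_real_def oct_e_def axis_def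

lemma oct_e_0_mult [simp]: "oct_e 0 \<odot> z = z" and oct_mult_e_0 [simp]: "z \<odot> oct_e 0 = z"
  by (simp_all add: vec_eq_iff forall_8 oct_component_simps)

lemma oct_table:
  "oct_e 1 \<odot> oct_e 2 = oct_e 4" "oct_e 1 \<odot> oct_e 3 = oct_e 5"
  "oct_e 2 \<odot> oct_e 3 = oct_e 6" "oct_e 4 \<odot> oct_e 3 = oct_e 7"
  by (simp_all add: vec_eq_iff forall_8 oct_component_simps)

lemma oct_conj_mult: "oct_conj (z \<odot> w) = oct_conj w \<odot> oct_conj z"
  by (simp add: vec_eq_iff forall_8 oct_component_simps algebra_simps)

lemma oct_mult_conj: "z \<odot> oct_conj z = oct_of_real (oct_N z)"
  by (simp add: vec_eq_iff forall_8 oct_component_simps oct_N_sum power2_eq_square algebra_simps)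

lemma oct_left_alternative: "z \<odot> (oct_conj z \<odot> w) = oct_N z *\<^sub>R w"
  by (simp only: vec_eq_iff forall_8 oct_mult_nth oct_conj_nth vector_scaleR_component real_scaleR_def oct_N_sum)
    (intro conjI; simp add: power2_eq_square algebra_simps)

lemma oct_conj_conj [simp]: "oct_conj (oct_conj z) = z"
  by (simp add: vec_eq_iff oct_conj_def)

lemma oct_N_conj [simp]: "oct_N (oct_conj z) = oct_N z"
  by (simp add: oct_N_sum oct_conj_nth)

lemma oct_conj_scaleR: "oct_conj (r *\<^sub>R z) = r *\<^sub>R oct_conj z"
  by (simp add: vec_eq_iff oct_conj_def)

lemma oct_right_alternative: "(w \<odot> oct_conj z) \<odot> z = oct_N z *\<^sub>R w"
  using arg_cong[OF oct_left_alternative[of "oct_conj z" "oct_conj w"], of oct_conj]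
  by (simp add: oct_conj_mult oct_conj_scaleR)

lemma oct_mult_scaleR: "z \<odot> (r *\<^sub>R w) = r *\<^sub>R (z \<odot> w)"
  by (simp add: vec_eq_iff forall_8 oct_mult_nth algebra_simps)

lemma oct_mult_inverse: "z \<noteq> 0 \<Longrightarrow> z \<odot> oct_inverse z = oct_e 0"
  by (simp add: oct_inverse_def oct_mult_scaleR oct_mult_conj oct_of_real_def oct_N_def)

text \<open>
  With the substitution \<open>z \<mapsto> lam (z \<mu>)\<close>, the kernel \<open>z\<^sup>* / |z|\<^sup>8\<close> is recovered up to a real factor by
  the bracketing \<open>\<mu>(\<dots> lam)\<close>, but not by \<open>(\<mu> \<dots>) lam\<close>, as \<open>lam = e\<^sub>1\<close>, \<open>\<mu> = e\<^sub>2\<close>, \<open>z = e\<^sub>3\<close> shows.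
\<close>

lemma oct_bracketing:
  "\<mu> \<odot> (oct_conj (lam \<odot> (z \<odot> \<mu>)) \<odot> lam) = (oct_N lam * oct_N \<mu>) *\<^sub>R oct_conj z"
  by (simp add: oct_conj_mult oct_right_alternative oct_left_alternative oct_mult_scaleR)

lemma oct_other_bracketing:
  "(oct_e 2 \<odot> oct_conj (oct_e 1 \<odot> (oct_e 3 \<odot> oct_e 2))) \<odot> oct_e 1 = - oct_conj (oct_e 3)"
proof -
  have "oct_e 3 \<odot> oct_e 2 = - oct_e 6" "oct_e 1 \<odot> (- oct_e 6) = oct_e 7"
       "oct_conj (oct_e 7) = - oct_e 7" "oct_e 2 \<odot> (- oct_e 7) = oct_e 5"
       "oct_e 5 \<odot> oct_e 1 = - oct_conj (oct_e 3)"
    by (simp_all add: vec_eq_iff forall_8 oct_component_simps)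
  then show ?thesis by (simp only:)
qed


section \<open>Cofactors\<close>

text \<open>
  The \<open>(h,j)\<close> minor with its sign \<open>(-1)\<^sup>h\<^sup>+\<^sup>j\<close>, written without deleting a row and a column, which
  would change the index types: row \<open>h\<close> and column \<open>j\<close> are replaced by zeros with a single
  \<open>1\<close> at position \<open>(h,j)\<close>.
\<close>

definition cofactor :: "real^'n^'n \<Rightarrow> 'n \<Rightarrow> 'n \<Rightarrow> real" where
  "cofactor A h j =
     det (\<chi> k l. if k = h \<and> l = j then 1 else if k = h \<or> l = j then 0 else A $ k $ l)"

lemma cofactor_column:
  "cofactor A h j = det (\<chi> k l. if l = j then (if k = h then 1 else 0) else A $ k $ l)"
proof -
  have "(\<Prod>k\<in>UNIV. if k = h \<and> p k = j then 1 else if k = h \<or> p k = j then 0 else A $ k $ p k) =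
        (\<Prod>k\<in>UNIV. if p k = j then (if k = h then 1 else 0) else A $ k $ p k)"
    if p: "p permutes (UNIV::'a set)" for p
  proof (cases "p h = j")
    case True
    then have "p k = j \<longleftrightarrow> k = h" for k
      using permutes_inj[OF p] by (metis injD)
    then show ?thesis by (intro prod.cong) auto
  next
    case False
    obtain k where k: "p k = j" using permutes_surj[OF p] by (metis surjD)
    with False have "k \<noteq> h" by auto
    have "(\<Prod>k\<in>UNIV. if k = h \<and> p k = j then 1 else if k = h \<or> p k = j then 0 else A $ k $ p k) = 0"
      using False by (intro prod_zero finite bexI[of _ h]) simp_all
    moreover have "(\<Prod>k\<in>UNIV. if p k = j then (if k = h then 1 else 0) else A $ k $ p k) = 0"
      using k \<open>k \<noteq> h\<close> by (intro prod_zero finite bexI[of _ k]) simp_all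
    ultimately show ?thesis by (simp only:)
  qed
  then show ?thesis
    unfolding cofactor_def det_def by (intro sum.cong) auto
qed

lemma sum_cofactor:
  "(\<Sum>h\<in>UNIV. A $ h $ i * cofactor A h l) = (if i = l then det A else 0)"
proof -
  let ?M = "\<lambda>v. \<chi> k m. if m = l then v $ k else A $ k $ m"
  have lin: "det (?M (\<Sum>h\<in>S. c h *\<^sub>R axis h 1)) = (\<Sum>h\<in>S. c h * cofactor A h l)" if "finite S" for S c
    using that
  proof (induction S)
    case empty
    show ?case
      by (simp, rule det_zero_column[of l]) (simp add: column_def vec_eq_iff)
  next
    case (insert s S)
    have tr: "det (?M v) = det (\<chi> m. if m = l then v else column m A)" for v
      by (subst det_transpose[symmetric])
         (auto intro!: arg_cong[of _ _ det] simp: transpose_def column_def vec_eq_iff)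
    have "det (?M (axis s 1)) = cofactor A s l"
      unfolding cofactor_column
      by (auto intro!: arg_cong[of _ _ det] simp: axis_def vec_eq_iff)
    moreover have "(\<Sum>h\<in>insert s S. c h *\<^sub>R axis h 1) = c s *s axis s 1 + (\<Sum>h\<in>S. c h *\<^sub>R axis h 1)"
      using insert by (simp add: scalar_mult_eq_scaleR)
    ultimately show ?case
      using insert unfolding tr by (simp only: det_row_add det_row_mul) simp
  qed
  have "(\<Sum>h\<in>UNIV. A $ h $ i *\<^sub>R axis h 1) = column i A"
    by (simp add: vec_eq_iff column_def axis_def if_distrib cong: if_cong)
  then have "(\<Sum>h\<in>UNIV. A $ h $ i * cofactor A h l) = det (?M (column i A))"
    using lin[of UNIV "\<lambda>h. A $ h $ i"] by (simp only: finite)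
  also have "\<dots> = (if i = l then det A else 0)"
  proof (cases "i = l")
    case True
    then have "?M (column i A) = A" by (simp add: vec_eq_iff column_def)
    with True show ?thesis by simp
  next
    case False
    then have "column i (?M (column i A)) = column l (?M (column i A))"
      by (simp add: vec_eq_iff column_def)
    with False show ?thesis
      by (subst det_identical_columns[of i l]) simp_all
  qed
  finally show ?thesis .
qed


section \<open>Lattices and Weierstrass functions\<close>

definition oct_lattice :: "(8 \<Rightarrow> octonion) \<Rightarrow> octonion set" where
  "oct_lattice \<omega> = {\<Sum>h\<in>UNIV. of_int (k h) *\<^sub>R \<omega> h | k :: 8 \<Rightarrow> int. True}"

definition fundamental_cell :: "(8 \<Rightarrow> octonion) \<Rightarrow> octonion set" where
  "fundamental_cell \<omega> = {\<Sum>h\<in>UNIV. \<alpha> h *\<^sub>R \<omega> h | \<alpha> :: 8 \<Rightarrow> real. \<forall>h. 0 \<le> \<alpha> h \<and> \<alpha> h < 1}"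

definition period_matrix :: "(8 \<Rightarrow> octonion) \<Rightarrow> real^8^8" where
  "period_matrix \<omega> = (\<chi> h j. \<omega> h $ j)"

definition division_points :: "(8 \<Rightarrow> octonion) \<Rightarrow> octonion \<Rightarrow> octonion \<Rightarrow> octonion set" where
  "division_points \<omega> lam \<mu> =
     {v \<in> fundamental_cell \<omega>.
        \<exists>w \<in> oct_lattice \<omega>. v = (oct_inverse lam \<odot> w) \<odot> oct_inverse \<mu>}"

definition q0 :: "octonion \<Rightarrow> octonion" where
  "q0 z = (1 / norm z ^ 8) *\<^sub>R oct_conj z"

definition q\<tau> :: "8 \<Rightarrow> octonion \<Rightarrow> octonion" where
  "q\<tau> j z = vector_derivative (\<lambda>t. q0 (z + t *\<^sub>R oct_e j)) (at 0)"

definition V\<tau> :: "8 \<Rightarrow> octonion \<Rightarrow> octonion" where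
  "V\<tau> j z = oct_of_real (z $ j) - (z $ 0) *\<^sub>R oct_e j"

definition wp\<tau> :: "8 \<Rightarrow> (8 \<Rightarrow> octonion) \<Rightarrow> octonion \<Rightarrow> octonion" where
  "wp\<tau> i \<omega> z =
     q\<tau> i z + (\<Sum>\<^sub>\<infinity>w\<in>oct_lattice \<omega> - {0}. q\<tau> i (z + w) - q\<tau> i w)"

text \<open>
  Since \<open>\<partial>q\<^sub>0/\<partial>x\<^sub>0 = - \<Sum>\<^sub>j e\<^sub>j \<partial>q\<^sub>0/\<partial>x\<^sub>j\<close>, the sum over \<open>j\<close> below is the linear Taylor term of
  \<open>q\<^sub>0(z + w)\<close> at \<open>w\<close>. It has to be subtracted: only with this sign is the summand
  \<open>O(|w|\<^sup>-\<^sup>9)\<close>, so that the series converges, and \<open>\<partial>\<zeta>/\<partial>x\<^sub>i = wp\<tau> i\<close>. It is sometimes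
  printed with a plus sign.
\<close>

definition oct_zeta :: "(8 \<Rightarrow> octonion) \<Rightarrow> octonion \<Rightarrow> octonion" where
  "oct_zeta \<omega> z =
     q0 z + (\<Sum>\<^sub>\<infinity>w\<in>oct_lattice \<omega> - {0}.
               q0 (z + w) - q0 w - (\<Sum>j\<in>UNIV - {0}. V\<tau> j z \<odot> q\<tau> j w))"

definition legendre_constants :: "(8 \<Rightarrow> octonion) \<Rightarrow> (8 \<Rightarrow> octonion) \<Rightarrow> bool" where
  "legendre_constants \<omega> \<eta> \<longleftrightarrow>
     (\<forall>h. \<forall>z. z \<notin> oct_lattice \<omega> \<longrightarrow> oct_zeta \<omega> (z + \<omega> h) - oct_zeta \<omega> z = \<eta> h)"

end

theory Submission
  imports Defs
begin

text \<open>
  Put \<open>T z = lam (z \<mu>)\<close>, a similarity with \<open>|T z|\<^sup>2 = N |z|\<^sup>2\<close> for \<open>N = N(lam) N(\<mu>)\<close>, and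
  \<open>L = T\<inverse>\<Omega>\<close>, a lattice containing \<open>\<Omega>\<close> whose classes modulo \<open>\<Omega>\<close> are represented by the division
  points. Since \<open>N\<^sup>3 \<mu> (q\<^sub>0(T z) lam) = q\<^sub>0(z)\<close>, the function \<open>N\<^sup>3 \<mu> (\<zeta>(T z) lam)\<close> is the
  zeta function of \<open>L\<close>. Summing its absolutely convergent series over the cosets \<open>v + \<Omega>\<close> gives
  \<open>\<Sum>\<^sub>v (\<zeta>(z + v) - \<zeta>(v) - P\<^sub>v(z))\<close>, where \<open>P\<^sub>v\<close> is linear and \<open>P\<^sub>v(e\<^sub>i)\<close> is the value of the
  \<open>i\<close>-th Weierstrass function at \<open>v\<close>; no Liouville theorem is needed. Comparing the increments
  under \<open>z \<mapsto> z + \<omega>\<^sub>h\<close>, using \<open>[L : \<Omega>] = N\<^sup>4\<close>, and combining the eight equations with the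
  cofactors, for which \<open>\<Sum>\<^sub>h \<Theta>\<^sub>h\<^sub>i \<omega>\<^sub>h = det(W) e\<^sub>i\<close>, yields the formula.
\<close>

section \<open>The kernel and its derivative\<close>

lemma inner_oct_mult_left: "(z \<odot> w) \<bullet> u = w \<bullet> (oct_conj z \<odot> u)"
  by (simp add: inner_vec_def sum_8 oct_mult_nth oct_conj_nth algebra_simps)

lemma inner_oct_mult_right: "(w \<odot> z) \<bullet> u = w \<bullet> (u \<odot> oct_conj z)"
  by (simp add: inner_vec_def sum_8 oct_mult_nth oct_conj_nth algebra_simps)

text \<open>Moving \<open>z\<close> across the inner product as its conjugate brings it next to
  itself, where the alternative law cancels the pair. Used for the inner and the outer factor in
  turn, this makes \<open>lam \<odot> (z \<odot> \<mu>)\<close> a similarity in \<open>z\<close>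
  without associativity.\<close>

lemma inner_oct_mult_same_left: "(z \<odot> x) \<bullet> (z \<odot> y) = oct_N z * (x \<bullet> y)"
  using oct_left_alternative[of "oct_conj z" y] by (simp add: inner_oct_mult_left)

lemma inner_oct_mult_same_right: "(x \<odot> z) \<bullet> (y \<odot> z) = oct_N z * (x \<bullet> y)"
  using oct_right_alternative[of y "oct_conj z"] by (simp add: inner_oct_mult_right)

lemma bounded_bilinear_oct_mult: "bounded_bilinear (\<odot>)"
  unfolding bilinear_conv_bounded_bilinear[symmetric] bilinear_def
  by (auto intro!: linearI simp: vec_eq_iff forall_8 oct_mult_nth algebra_simps)

lemma bounded_linear_oct_conj: "bounded_linear oct_conj"
  unfolding linear_conv_bounded_linear[symmetric]
  by (auto intro!: linearI simp: vec_eq_iff oct_conj_def)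

lemma norm_oct_conj [simp]: "norm (oct_conj z) = norm z"
  using oct_N_conj[of z] by (simp add: oct_N_def)

text \<open>The inverse is a real multiple of the conjugate, so the alternative laws supply the one
  instance of associativity that cancellation requires.\<close>

lemma oct_left_inverse_mult:
  assumes "lam \<noteq> 0"
  shows "oct_inverse lam \<odot> (lam \<odot> z) = z" "lam \<odot> (oct_inverse lam \<odot> z) = z"
  using assms oct_left_alternative[of "oct_conj lam" z] oct_left_alternative[of lam z]
  by (simp_all add: oct_inverse_def oct_mult_scaleR oct_N_def
      linear_simps(5)[OF bounded_bilinear.bounded_linear_left[OF bounded_bilinear_oct_mult]])

lemma oct_right_inverse_mult:
  assumes "lam \<noteq> 0"
  shows "(z \<odot> lam) \<odot> oct_inverse lam = z" "(z \<odot> oct_inverse lam) \<odot> lam = z"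
  using assms oct_right_alternative[of z "oct_conj lam"] oct_right_alternative[of z lam]
  by (simp_all add: oct_inverse_def oct_mult_scaleR oct_N_def
      linear_simps(5)[OF bounded_bilinear.bounded_linear_left[OF bounded_bilinear_oct_mult]])

section \<open>The differential of the kernel\<close>

text \<open>
  The total derivative of \<open>q0\<close>. Division by zero makes \<open>q0\<close> and \<open>Dq0\<close> vanish at \<open>0\<close>, so the
  isolated leading terms \<open>q\<^sub>0(z)\<close> and \<open>q\<^bsub>\<tau>(i)\<^esub>(z)\<close> of the two series are their regular terms at
  the lattice point \<open>0\<close>.
\<close>

definition Dq0 :: "octonion \<Rightarrow> octonion \<Rightarrow> octonion" where
  "Dq0 w z = (1 / norm w ^ 8) *\<^sub>R oct_conj z - (8 * (w \<bullet> z) / norm w ^ 10) *\<^sub>R oct_conj w"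

lemma Dq0_0 [simp]: "Dq0 0 z = 0"
  by (simp add: Dq0_def)

lemma q0_0 [simp]: "q0 0 = 0"
  by (simp add: q0_def)

lemma bounded_linear_Dq0: "bounded_linear (Dq0 w)"
  unfolding Dq0_def linear_conv_bounded_linear[symmetric]
  by (intro linearI) (simp_all add: vec_eq_iff oct_conj_def inner_add_right algebra_simps add_divide_distrib diff_divide_distrib)

lemma has_derivative_q0:
  assumes "w \<noteq> 0"
  shows "(q0 has_derivative Dq0 w) (at w within S)"
proof -
  \<comment> \<open>Even powers of the norm become powers of \<open>z \<bullet> z\<close>, so that
    only a polynomial, an inverse and a linear map have to be differentiated.\<close>
  have q0_eq: "q0 = (\<lambda>z. inverse ((z \<bullet> z) ^ 4) *\<^sub>R oct_conj z)"
    by (simp add: q0_def fun_eq_iff power2_norm_eq_inner[symmetric] divide_inverse flip: power_mult)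
  have "norm w ^ 10 = (w \<bullet> w) ^ 5" "norm w ^ 8 = (w \<bullet> w) ^ 4"
    by (simp_all add: power2_norm_eq_inner[symmetric] flip: power_mult)
  note pw = this
  have "w \<bullet> w \<noteq> 0" using assms by simp
  then show ?thesis
    unfolding q0_eq Dq0_def pw using assms
    by (auto intro!: derivative_eq_intros bounded_linear.has_derivative[OF bounded_linear_oct_conj]
        simp: fun_eq_iff inner_commute field_simps power_numeral_reduce scaleR_diff_left)
qed

text \<open>Restricted to \<open>w \<noteq> 0\<close>: at the origin \<open>q0\<close> blows up, and
  the derivative that defines \<open>q\<tau>\<close> does not exist.\<close>

lemma q\<tau>_eq_Dq0:
  assumes "w \<noteq> 0"
  shows "q\<tau> j w = Dq0 w (oct_e j)"
proof -
  have "((\<lambda>t. w + t *\<^sub>R oct_e j) has_derivative (\<lambda>t. t *\<^sub>R oct_e j)) (at 0)"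
    by (auto intro!: derivative_eq_intros)
  moreover have "(q0 has_derivative Dq0 w) (at (w + 0 *\<^sub>R oct_e j))"
    using has_derivative_q0[OF assms] by simp
  ultimately have "((\<lambda>t. q0 (w + t *\<^sub>R oct_e j)) has_derivative (\<lambda>t. Dq0 w (t *\<^sub>R oct_e j))) (at 0)"
    by (rule has_derivative_compose)
  then have "((\<lambda>t. q0 (w + t *\<^sub>R oct_e j)) has_vector_derivative Dq0 w (oct_e j)) (at 0)"
    by (simp add: has_vector_derivative_def linear_simps[OF bounded_linear_Dq0])
  then show ?thesis
    unfolding q\<tau>_def by (rule vector_derivative_at)
qed

lemma sum_oct_e: "(\<Sum>j\<in>UNIV. z $ j *\<^sub>R oct_e j) = z"
  using basis_expansion[of z] by (simp add: oct_e_def scalar_mult_eq_scaleR)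

text \<open>The Cauchy-Riemann equation of the kernel. The first parts of \<open>Dq0\<close>
  contribute \<open>8 / norm w ^ 8\<close>, one eighth for each unit; the second parts collect to
  \<open>w\<close> times its conjugate with weight \<open>8 / norm w ^ 10\<close>. They cancel
  because the exponent equals the dimension.\<close>

lemma q0_left_monogenic: "(\<Sum>j\<in>UNIV. oct_e j \<odot> Dq0 w (oct_e j)) = 0"
proof (cases "w = 0")
  case False
  interpret bounded_bilinear "(\<odot>)" by (rule bounded_bilinear_oct_mult)
  have e: "oct_e j \<odot> oct_conj (oct_e j) = oct_e 0" for j
    by (simp add: oct_mult_conj oct_N_def oct_of_real_def) (simp add: oct_e_def)
  have "(\<Sum>j\<in>UNIV. oct_e j \<odot> Dq0 w (oct_e j)) =
      (8 / norm w ^ 8) *\<^sub>R oct_e 0 - (8 / norm w ^ 10) *\<^sub>R ((\<Sum>j\<in>UNIV. w $ j *\<^sub>R oct_e j) \<odot> oct_conj w)"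
    using inner_axis[of w _ 1, folded oct_e_def]
    by (simp add: Dq0_def diff_right scaleR_right scaleR_left sum_left e sum_subtractf scaleR_sum_right
        sum_constant_scaleR mult.commute del: sum_constant)
  also have "\<dots> = (8 / norm w ^ 8 - 8 / norm w ^ 10 * (norm w)\<^sup>2) *\<^sub>R oct_e 0"
    by (simp add: sum_oct_e oct_mult_conj oct_of_real_def oct_N_def scaleR_diff_left)
  also have "8 / norm w ^ 8 - 8 / norm w ^ 10 * (norm w)\<^sup>2 = 0"
    using False by (simp add: field_simps flip: power_add)
  finally show ?thesis by simp
qed (simp add: bounded_bilinear.zero_right[OF bounded_bilinear_oct_mult])

text \<open>By the preceding equation the parts of \<open>V\<tau>\<close> with \<open>z $ 0\<close>
  supply the missing derivative in direction \<open>oct_e 0\<close>, so the sum over seven indices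
  is the full linear Taylor term.\<close>

lemma sum_V\<tau>_Dq0: "(\<Sum>j\<in>UNIV - {0}. V\<tau> j z \<odot> Dq0 w (oct_e j)) = Dq0 w z"
proof -
  interpret bounded_bilinear "(\<odot>)" by (rule bounded_bilinear_oct_mult)
  \<comment> \<open>The index \<open>0\<close> may be added, as
    \<open>V\<tau> 0 z = 0\<close>.\<close>
  have "(\<Sum>j\<in>UNIV - {0}. V\<tau> j z \<odot> Dq0 w (oct_e j)) = (\<Sum>j\<in>UNIV. V\<tau> j z \<odot> Dq0 w (oct_e j))"
    by (rule sum.mono_neutral_left) (auto simp: V\<tau>_def oct_of_real_def zero_left)
  also have "\<dots> = (\<Sum>j\<in>UNIV. Dq0 w (z $ j *\<^sub>R oct_e j)) - z $ 0 *\<^sub>R (\<Sum>j\<in>UNIV. oct_e j \<odot> Dq0 w (oct_e j))"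
    by (simp add: V\<tau>_def oct_of_real_def diff_left scaleR_left sum_subtractf scaleR_sum_right
        linear_simps(5)[OF bounded_linear_Dq0])
  also have "\<dots> = Dq0 w (\<Sum>j\<in>UNIV. z $ j *\<^sub>R oct_e j)"
    by (simp only: linear_sum[OF bounded_linear.linear[OF bounded_linear_Dq0]] q0_left_monogenic
        scaleR_zero_right diff_zero)
  finally show ?thesis by (simp add: sum_oct_e)
qed

section \<open>Decay estimates for the kernel and its differential\<close>

lemma abs_inverse_power_diff_le:
  fixes a b d :: real
  assumes "0 < a" "\<bar>a - b\<bar> \<le> d" "2 * d \<le> a"
  shows "\<bar>1 / b ^ Suc n - 1 / a ^ Suc n\<bar> \<le> Suc n * 2 ^ Suc n * d / a ^ Suc (Suc n)"
proof -
  have b: "b \<ge> a / 2" "0 < b" using assms by auto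
  have "1 / b \<le> 2 / a" using b assms by (simp add: field_simps)
  have "\<bar>1 / b - 1 / a\<bar> = \<bar>a - b\<bar> * (1 / b) / a"
    using b assms(1) by (simp add: field_simps abs_if)
  also have "\<dots> \<le> d * (2 / a) / a"
    using assms b \<open>1 / b \<le> 2 / a\<close> by (intro divide_right_mono mult_mono) auto
  finally have 1: "\<bar>1 / b - 1 / a\<bar> \<le> 2 * d / a^2" by (simp add: power2_eq_square mult.commute)
  \<comment> \<open>In the factorization of a difference of powers, both \<open>1 / a\<close> and
    \<open>1 / b\<close> are at most \<open>2 / a\<close>, because
    \<open>b \<ge> a / 2\<close>.\<close>
  have "(\<Sum>p<Suc n. (1 / b) ^ p * (1 / a) ^ (n - p)) \<le> (\<Sum>p<Suc n. (2 / a) ^ n)"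
  proof (rule sum_mono)
    fix p assume "p \<in> {..<Suc n}"
    have "(1 / b) ^ p * (1 / a) ^ (n - p) \<le> (2 / a) ^ p * (2 / a) ^ (n - p)"
      using assms(1) b \<open>1 / b \<le> 2 / a\<close> by (intro mult_mono power_mono) (auto simp: divide_right_mono)
    also have "\<dots> = (2 / a) ^ n"
      using \<open>p \<in> {..<Suc n}\<close> by (simp flip: power_add)
    finally show "(1 / b) ^ p * (1 / a) ^ (n - p) \<le> (2 / a) ^ n" .
  qed
  then have 2: "(\<Sum>p<Suc n. (1 / b) ^ p * (1 / a) ^ (n - p)) \<le> Suc n * (2 / a) ^ n"
    by simp
  have "\<bar>1 / b ^ Suc n - 1 / a ^ Suc n\<bar> = \<bar>(1 / b) ^ Suc n - (1 / a) ^ Suc n\<bar>"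
    by (simp add: power_one_over)
  also have "\<dots> = \<bar>1 / b - 1 / a\<bar> * (\<Sum>p<Suc n. (1 / b) ^ p * (1 / a) ^ (n - p))"
  proof -
    have "0 \<le> (\<Sum>p<Suc n. (1 / b) ^ p * (1 / a) ^ (n - p))"
      using b assms(1) by (intro sum_nonneg) auto
    moreover have "(1 / b) ^ Suc n - (1 / a) ^ Suc n =
        (1 / b - 1 / a) * (\<Sum>p<Suc n. (1 / b) ^ p * (1 / a) ^ (n - p))"
      unfolding power_diff_sumr2 by (simp only: diff_Suc_Suc mult.commute)
    ultimately show ?thesis by (simp only: abs_mult abs_of_nonneg)
  qed
  also have "\<dots> \<le> (2 * d / a^2) * (Suc n * (2 / a) ^ n)"
    using 1 2 b assms by (intro mult_mono sum_nonneg) auto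
  also have "\<dots> = Suc n * 2 ^ Suc n * d / a ^ Suc (Suc n)"
    using assms(1) by (simp add: power_divide power2_eq_square field_simps)
  finally show ?thesis .
qed

text \<open>\<open>Dq0 w z\<close> is homogeneous of degree -8 in \<open>w\<close>, so an increment
  \<open>y\<close> costs one more power of the norm. The constant is the sum 2048 + 81920 + 16384 +
  8192 of the bounds for the four terms in the proof.\<close>

lemma norm_Dq0_diff_le:
  assumes x: "x \<noteq> 0" and y: "2 * norm y \<le> norm x"
  shows "norm (Dq0 (x + y) z - Dq0 x z) \<le> 108544 * norm y * norm z / norm x ^ 9"
proof -
  define a b d where "a = norm x" and "b = norm (x + y)" and "d = norm y"
  have a: "a > 0" and d: "d \<ge> 0" "2 * d \<le> a" using x y by (auto simp: a_def d_def)
  have ab: "\<bar>a - b\<bar> \<le> d"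
    unfolding a_def b_def d_def using norm_triangle_ineq3[of x "x + y"] by simp
  then have b: "a / 2 \<le> b" "b \<le> 2 * a" "b > 0" using a d by auto
  \<comment> \<open>The constants are 8 times 2^8 here and 10 times 2^10 for the tenth
    power.\<close>
  have e8: "\<bar>1 / b ^ 8 - 1 / a ^ 8\<bar> \<le> 2048 * d / a ^ 9"
    using abs_inverse_power_diff_le[OF a ab d(2), of 7] by simp
  have e10: "\<bar>1 / b ^ 10 - 1 / a ^ 10\<bar> \<le> 10240 * d / a ^ 11"
    using abs_inverse_power_diff_le[OF a ab d(2), of 9] by simp
  have b10: "1 / b ^ 10 \<le> 1024 / a ^ 10"
  proof -
    have "(a / 2) ^ 10 \<le> b ^ 10" using a b by (intro power_mono) auto
    then show ?thesis using a b by (simp add: field_simps power_divide)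
  qed
  have in_le: "\<bar>u \<bullet> z\<bar> \<le> norm u * norm z" for u
    by (rule Cauchy_Schwarz_ineq2)
  \<comment> \<open>One factor is changed at a time: the eighth power, the tenth power, and the two
    occurrences of the base point in the quadratic part.\<close>
  have eq: "Dq0 (x + y) z - Dq0 x z =
      (1 / b ^ 8 - 1 / a ^ 8) *\<^sub>R oct_conj z
      - (8 * (1 / b ^ 10 - 1 / a ^ 10) * (x \<bullet> z)) *\<^sub>R oct_conj x
      - (8 * (1 / b ^ 10) * (y \<bullet> z)) *\<^sub>R oct_conj (x + y)
      - (8 * (1 / b ^ 10) * (x \<bullet> z)) *\<^sub>R oct_conj y"
    by (simp add: Dq0_def a_def b_def vec_eq_iff oct_conj_def inner_add_left algebra_simps diff_divide_distrib add_divide_distrib)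
  have t1: "norm ((1 / b ^ 8 - 1 / a ^ 8) *\<^sub>R oct_conj z) \<le> (2048 * d / a ^ 9) * norm z"
    using mult_right_mono[OF e8 norm_ge_zero[of z]] by simp
  have "norm ((8 * (1 / b ^ 10 - 1 / a ^ 10) * (x \<bullet> z)) *\<^sub>R oct_conj x)
      = 8 * \<bar>1 / b ^ 10 - 1 / a ^ 10\<bar> * \<bar>x \<bullet> z\<bar> * a"
    by (simp only: norm_scaleR norm_oct_conj abs_mult a_def abs_numeral)
  also have "\<dots> \<le> 8 * (10240 * d / a ^ 11) * (a * norm z) * a"
    using e10 in_le[of x] a d by (intro mult_mono) (auto simp: a_def)
  also have "\<dots> = (81920 * d / a ^ 9) * norm z"
    using a by (simp add: field_simps power_numeral_reduce)
  finally have t2: "norm ((8 * (1 / b ^ 10 - 1 / a ^ 10) * (x \<bullet> z)) *\<^sub>R oct_conj x) \<le> (81920 * d / a ^ 9) * norm z" .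
  have "norm ((8 * (1 / b ^ 10) * (y \<bullet> z)) *\<^sub>R oct_conj (x + y)) = 8 * (1 / b ^ 10) * \<bar>y \<bullet> z\<bar> * b"
    by (simp add: abs_mult b_def)
  also have "\<dots> \<le> 8 * (1024 / a ^ 10) * (d * norm z) * (2 * a)"
    using b10 in_le[of y] a b d by (intro mult_mono) (auto simp: d_def)
  also have "\<dots> = (16384 * d / a ^ 9) * norm z"
    using a by (simp add: field_simps power_numeral_reduce)
  finally have t3: "norm ((8 * (1 / b ^ 10) * (y \<bullet> z)) *\<^sub>R oct_conj (x + y)) \<le> (16384 * d / a ^ 9) * norm z" .
  have "norm ((8 * (1 / b ^ 10) * (x \<bullet> z)) *\<^sub>R oct_conj y) = 8 * (1 / b ^ 10) * \<bar>x \<bullet> z\<bar> * d"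
    using b by (simp add: abs_mult d_def)
  also have "\<dots> \<le> 8 * (1024 / a ^ 10) * (a * norm z) * d"
    using b10 in_le[of x] a b d by (intro mult_mono) (auto simp: a_def)
  also have "\<dots> = (8192 * d / a ^ 9) * norm z"
    using a by (simp add: field_simps power_numeral_reduce)
  finally have t4: "norm ((8 * (1 / b ^ 10) * (x \<bullet> z)) *\<^sub>R oct_conj y) \<le> (8192 * d / a ^ 9) * norm z" .
  have "norm (Dq0 (x + y) z - Dq0 x z) \<le> (2048 * d / a ^ 9) * norm z + (81920 * d / a ^ 9) * norm z
      + (16384 * d / a ^ 9) * norm z + (8192 * d / a ^ 9) * norm z"
    unfolding eq by (intro order_trans[OF norm_triangle_ineq4] add_mono t1 t2 t3 t4)
  then show ?thesis
    by (simp add: a_def d_def field_simps)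
qed

text \<open>The mean value inequality, with the variation of the derivative over a ball around
  \<open>x\<close> bounded by the previous lemma. The exponent 9 exceeds the dimension 8, which is
  what makes the lattice sums converge.\<close>

lemma norm_q0_Taylor_le:
  assumes x: "x \<noteq> 0" and z: "2 * norm z \<le> norm x"
  shows "norm (q0 (x + z) - q0 x - Dq0 x z) \<le> 108544 * (norm z)\<^sup>2 / norm x ^ 9"
proof -
  have "norm (q0 (x + z) - q0 x - Dq0 x (x + z - x)) \<le> norm (x + z - x) * (108544 * norm z / norm x ^ 9)"
  proof (rule differentiable_bound_linearization[where f' = Dq0 and S = "cball x (norm z)"])
    fix t :: real assume "t \<in> {0..1}"
    then show "x + t *\<^sub>R (x + z - x) \<in> cball x (norm z)"
      by (simp add: dist_norm mult_left_le_one_le)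
  next
    fix y assume y: "y \<in> cball x (norm z)"
    then have le: "norm (y - x) \<le> norm z" by (simp add: dist_norm norm_minus_commute)
    \<comment> \<open>The ball avoids the singularity, since its radius is at most half of
      \<open>norm x\<close>.\<close>
    have "norm x - norm z \<le> norm y"
      using le norm_triangle_ineq2[of x "x - y"] by (simp add: norm_minus_commute)
    moreover have "0 < norm x" using x by simp
    ultimately have "norm y > 0" using z norm_ge_zero[of z] by linarith
    then have "y \<noteq> 0" by simp
    then show "(q0 has_derivative Dq0 y) (at y within cball x (norm z))"
      by (rule has_derivative_q0)
    have "norm ((Dq0 y - Dq0 x) u) \<le> 108544 * norm z / norm x ^ 9 * norm u" for u
    proof -
      have "norm (Dq0 (x + (y - x)) u - Dq0 x u) \<le> 108544 * norm (y - x) * norm u / norm x ^ 9"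
        using le z by (intro norm_Dq0_diff_le x) auto
      also have "\<dots> \<le> 108544 * norm z * norm u / norm x ^ 9"
        using le by (intro divide_right_mono mult_mono) auto
      finally show ?thesis by simp
    qed
    then show "onorm (Dq0 y - Dq0 x) \<le> 108544 * norm z / norm x ^ 9"
      by (intro onorm_bound) auto
  qed auto
  then show ?thesis
    by (simp add: power2_eq_square mult.left_commute)
qed

section \<open>Lattice sums\<close>

lemma summable_on_abs_int_powr:
  fixes s :: real
  assumes "s > 1"
  shows "(\<lambda>k::int. (1 + \<bar>of_int k\<bar>) powr - s) summable_on UNIV"
proof -
  have "summable (\<lambda>n. real (Suc n) powr - s)"
    using assms by (subst summable_Suc_iff) (simp add: summable_real_powr_iff)
  then have "(\<lambda>n::nat. (1 + real n) powr - s) summable_on UNIV"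
    by (intro norm_summable_imp_summable_on) (simp add: add.commute)
  moreover have "bij_betw int UNIV {0..}"
    by (rule bij_betw_byWitness[where f' = nat]) auto
  moreover have "bij_betw (\<lambda>n. - int n) UNIV {..0}"
    by (rule bij_betw_byWitness[where f' = "\<lambda>k. nat (- k)"]) auto
  ultimately have "(\<lambda>k::int. (1 + \<bar>of_int k\<bar>) powr - s) summable_on {0..}"
      "(\<lambda>k::int. (1 + \<bar>of_int k\<bar>) powr - s) summable_on {..0}"
    using summable_on_reindex_bij_betw[of int UNIV "{0..}" "\<lambda>k. (1 + \<bar>of_int k\<bar>) powr - s"]
      summable_on_reindex_bij_betw[of "\<lambda>n. - int n" UNIV "{..0}" "\<lambda>k. (1 + \<bar>of_int k\<bar>) powr - s"]
    by simp_all
  \<comment> \<open>Both half-lines contain \<open>0\<close>; the overlap is harmless for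
    summability.\<close>
  then have "(\<lambda>k::int. (1 + \<bar>of_int k\<bar>) powr - s) summable_on {0..} \<union> {..0}"
    by (rule summable_on_union)
  moreover have "{0..} \<union> {..0} = (UNIV :: int set)"
    by auto
  ultimately show ?thesis by simp
qed

text \<open>A finite set of tuples lies in the box spanned by its coordinate projections. Over a box
  the sum of products factors, so every finite partial sum is at most a power of the one-dimensional
  sum.\<close>

lemma summable_on_prod_fun:
  fixes f :: "'b \<Rightarrow> real"
  assumes "\<And>x. f x \<ge> 0" "f summable_on UNIV"
  shows "(\<lambda>k::'a::finite \<Rightarrow> 'b. \<Prod>h\<in>UNIV. f (k h)) summable_on UNIV"
proof (rule nonneg_bdd_above_summable_on)
  show "bdd_above (sum (\<lambda>k::'a \<Rightarrow> 'b. \<Prod>h\<in>UNIV. f (k h)) ` {F. F \<subseteq> UNIV \<and> finite F})"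
  proof (rule bdd_aboveI2)
    fix F :: "('a \<Rightarrow> 'b) set" assume "F \<in> {F. F \<subseteq> UNIV \<and> finite F}"
    then have fin: "finite F" by simp
    have "(\<Sum>k\<in>F. \<Prod>h\<in>UNIV. f (k h)) \<le> (\<Sum>k\<in>PiE UNIV (\<lambda>h. (\<lambda>k. k h) ` F). \<Prod>h\<in>UNIV. f (k h))"
      using fin assms(1) by (intro sum_mono2 finite_PiE prod_nonneg) auto
    also have "\<dots> = (\<Prod>h\<in>UNIV. \<Sum>x\<in>(\<lambda>k. k h) ` F. f x)"
      using fin by (subst prod_sum_PiE) auto
    also have "\<dots> \<le> (\<Prod>h\<in>(UNIV::'a set). infsum f UNIV)"
      using fin assms by (intro prod_mono conjI sum_nonneg finite_sum_le_infsum) auto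
    finally show "(\<Sum>k\<in>F. \<Prod>h\<in>UNIV. f (k h)) \<le> (\<Prod>h\<in>(UNIV::'a set). infsum f UNIV)" .
  qed
qed (auto intro: prod_nonneg assms)

section \<open>The period lattice in coordinates\<close>

locale oct_lattice_basis =
  fixes \<omega> :: "8 \<Rightarrow> octonion"
  assumes inj_basis: "inj \<omega>" and independent_basis: "independent (range \<omega>)"
begin

text \<open>These coordinates turn the lattice into the integer points and the cell into the
  half-open unit cube, so that floors and measurability can be treated componentwise.\<close>

definition \<Phi> :: "real^8 \<Rightarrow> octonion" where
  "\<Phi> x = (\<Sum>h\<in>UNIV. x $ h *\<^sub>R \<omega> h)"

lemma linear_\<Phi>: "linear \<Phi>"
  unfolding \<Phi>_def by (intro linearI) (simp_all add: algebra_simps sum.distrib scaleR_sum_right)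

lemma \<Phi>_axis: "\<Phi> (axis h 1) = \<omega> h"
  by (simp add: \<Phi>_def axis_def if_distrib[of "\<lambda>r. r *\<^sub>R _"] cong: if_cong)

lemma inj_\<Phi>: "inj \<Phi>"
proof (subst linear_injective_0[OF linear_\<Phi>], intro allI impI)
  fix x assume "\<Phi> x = 0"
  \<comment> \<open>Independence concerns the set \<open>range \<omega>\<close>; by injectivity,
    \<open>inv \<omega>\<close> transports the coefficients to it.\<close>
  then have "(\<Sum>v\<in>range \<omega>. (x $ inv \<omega> v) *\<^sub>R v) = 0"
    by (subst sum.reindex[OF inj_basis]) (simp add: \<Phi>_def inv_f_f[OF inj_basis])
  then have "x $ inv \<omega> (\<omega> h) = 0" for h
    using independentD[OF independent_basis finite_imageI[OF finite] subset_refl, of "\<lambda>v. x $ inv \<omega> v"] by blast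
  then show "x = 0"
    by (simp add: inv_f_f[OF inj_basis] vec_eq_iff)
qed

lemma bij_\<Phi>: "bij \<Phi>"
  using inj_\<Phi> linear_injective_imp_surjective[OF linear_\<Phi> inj_\<Phi>] by (simp add: bij_def)

lemma lattice_eq_image: "oct_lattice \<omega> = \<Phi> ` {x. \<forall>h. x $ h \<in> \<int>}"
proof (intro set_eqI iffI)
  fix w assume "w \<in> oct_lattice \<omega>"
  then obtain k :: "8 \<Rightarrow> int" where "w = (\<Sum>h\<in>UNIV. of_int (k h) *\<^sub>R \<omega> h)"
    unfolding oct_lattice_def by blast
  then show "w \<in> \<Phi> ` {x. \<forall>h. x $ h \<in> \<int>}"
    by (intro image_eqI[where x = "\<chi> h. of_int (k h)"]) (auto simp: \<Phi>_def)
next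
  fix w assume "w \<in> \<Phi> ` {x. \<forall>h. x $ h \<in> \<int>}"
  then obtain x where x: "w = \<Phi> x" "\<forall>h. x $ h \<in> \<int>" by blast
  then have "w = (\<Sum>h\<in>UNIV. of_int \<lfloor>x $ h\<rfloor> *\<^sub>R \<omega> h)"
    by (simp add: \<Phi>_def of_int_floor_cancel Ints_cases)
  then show "w \<in> oct_lattice \<omega>"
    unfolding oct_lattice_def by (auto intro!: exI[of _ "\<lambda>h. \<lfloor>x $ h\<rfloor>"])
qed

lemma cell_eq_image: "fundamental_cell \<omega> = \<Phi> ` {x. \<forall>h. 0 \<le> x $ h \<and> x $ h < 1}"
proof (intro set_eqI iffI)
  fix v assume "v \<in> fundamental_cell \<omega>"
  then obtain a where "v = (\<Sum>h\<in>UNIV. a h *\<^sub>R \<omega> h)" "\<forall>h. 0 \<le> a h \<and> a h < 1"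
    unfolding fundamental_cell_def by blast
  then show "v \<in> \<Phi> ` {x. \<forall>h. 0 \<le> x $ h \<and> x $ h < 1}"
    by (intro image_eqI[where x = "\<chi> h. a h"]) (auto simp: \<Phi>_def)
qed (auto simp: fundamental_cell_def \<Phi>_def)

lemma lattice_0: "0 \<in> oct_lattice \<omega>"
  and lattice_add: "u \<in> oct_lattice \<omega> \<Longrightarrow> v \<in> oct_lattice \<omega> \<Longrightarrow> u + v \<in> oct_lattice \<omega>"
  and lattice_minus: "u \<in> oct_lattice \<omega> \<Longrightarrow> - u \<in> oct_lattice \<omega>"
  and lattice_basis: "\<omega> h \<in> oct_lattice \<omega>"
proof -
  show "0 \<in> oct_lattice \<omega>"
    unfolding lattice_eq_image by (intro image_eqI[of _ _ 0]) (simp_all add: linear_0[OF linear_\<Phi>])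
  show "u + v \<in> oct_lattice \<omega>" if uv: "u \<in> oct_lattice \<omega>" "v \<in> oct_lattice \<omega>"
  proof -
    obtain x y where "u = \<Phi> x" "v = \<Phi> y" "\<forall>h. x $ h \<in> \<int>" "\<forall>h. y $ h \<in> \<int>"
      using uv unfolding lattice_eq_image by blast
    then show ?thesis
      unfolding lattice_eq_image by (intro image_eqI[of _ _ "x + y"]) (simp_all add: linear_add[OF linear_\<Phi>])
  qed
  show "- u \<in> oct_lattice \<omega>" if u: "u \<in> oct_lattice \<omega>"
  proof -
    obtain x where "u = \<Phi> x" "\<forall>h. x $ h \<in> \<int>"
      using u unfolding lattice_eq_image by blast
    then show ?thesis
      unfolding lattice_eq_image by (intro image_eqI[of _ _ "- x"]) (simp_all add: linear_neg[OF linear_\<Phi>])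
  qed
  show "\<omega> h \<in> oct_lattice \<omega>"
    unfolding lattice_eq_image
    by (intro image_eqI[of _ _ "axis h 1"]) (simp add: \<Phi>_axis, simp add: axis_def)
qed

lemma lattice_diff: "u \<in> oct_lattice \<omega> \<Longrightarrow> v \<in> oct_lattice \<omega> \<Longrightarrow> u - v \<in> oct_lattice \<omega>"
  using lattice_add[of u "- v"] lattice_minus[of v] by simp

text \<open>The lattice point is the coordinatewise floor, and half-openness of the cell leaves no
  other choice.\<close>

lemma ex1_lattice_cell: "\<exists>!w\<in>oct_lattice \<omega>. z - w \<in> fundamental_cell \<omega>"
proof -
  obtain x where x: "z = \<Phi> x" using bij_\<Phi> by (metis bij_pointE)
  let ?f = "(\<chi> h. of_int \<lfloor>x $ h\<rfloor>) :: real^8"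
  have "z - \<Phi> ?f = \<Phi> (x - ?f)" by (simp add: x linear_diff[OF linear_\<Phi>])
  then have 1: "\<Phi> ?f \<in> oct_lattice \<omega> \<and> z - \<Phi> ?f \<in> fundamental_cell \<omega>"
    unfolding lattice_eq_image cell_eq_image
    by (auto intro!: imageI simp: of_int_floor_le) linarith
  have 2: "w = \<Phi> ?f" if "w \<in> oct_lattice \<omega> \<and> z - w \<in> fundamental_cell \<omega>" for w
  proof -
    from that obtain y f where y: "w = \<Phi> y" "\<forall>h. y $ h \<in> \<int>"
      and f: "z - w = \<Phi> f" "\<forall>h. 0 \<le> f $ h \<and> f $ h < 1"
      unfolding lattice_eq_image cell_eq_image by blast
    have "\<Phi> (x - y) = \<Phi> f" using x y f by (simp add: linear_diff[OF linear_\<Phi>])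
    then have f_eq: "f = x - y" using inj_\<Phi> by (simp add: inj_eq)
    have "y $ h = of_int \<lfloor>x $ h\<rfloor>" for h
    proof -
      obtain k where "y $ h = of_int k" using y(2) Ints_cases by blast
      moreover have "0 \<le> x $ h - y $ h" "x $ h - y $ h < 1" using f(2) f_eq by auto
      ultimately show ?thesis by (simp add: eq_commute[of k] floor_unique)
    qed
    then have "y = ?f" by (simp add: vec_eq_iff)
    then show "w = \<Phi> ?f" by (simp add: y(1))
  qed
  show ?thesis
    using 1 2 by (intro ex1I[of _ "\<Phi> ?f"]) blast+
qed

lemma countable_lattice: "countable (oct_lattice \<omega>)"
proof -
  have "oct_lattice \<omega> = range (\<lambda>k :: 8 \<Rightarrow> int. \<Sum>h\<in>UNIV. of_int (k h) *\<^sub>R \<omega> h)"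
    by (auto simp: oct_lattice_def)
  then show ?thesis by simp
qed

text \<open>An injective linear map in finite dimension is bounded below. Hence a bound on a lattice
  point confines its integer coordinates.\<close>

lemma lattice_norm_lower_bound: "\<exists>c>0. \<forall>x h. c * \<bar>x $ h\<bar> \<le> norm (\<Phi> x)"
proof (rule linear_inj_bounded_below_pos[OF linear_\<Phi> inj_\<Phi>])
  fix c assume c: "0 < c" "\<And>x. c * norm x \<le> norm (\<Phi> x)"
  have "c * \<bar>x $ h\<bar> \<le> norm (\<Phi> x)" for x h
    using mult_left_mono[OF component_le_norm_cart[of x h], of c] c(1) c(2)[of x] by linarith
  then show ?thesis using c(1) by auto
qed

definition lattice_point :: "(8 \<Rightarrow> int) \<Rightarrow> octonion" where
  "lattice_point k = \<Phi> (\<chi> h. of_int (k h))"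

lemma bij_betw_lattice_point: "bij_betw lattice_point UNIV (oct_lattice \<omega>)"
proof -
  have "oct_lattice \<omega> = range lattice_point"
    by (auto simp: oct_lattice_def lattice_point_def \<Phi>_def)
  moreover have "inj lattice_point"
  proof (rule injI)
    fix k l assume "lattice_point k = lattice_point l"
    then have "(\<chi> h. of_int (k h)) = ((\<chi> h. of_int (l h)) :: real^8)"
      using inj_\<Phi> by (simp add: lattice_point_def inj_eq)
    then show "k = l"
      by (simp add: vec_eq_iff fun_eq_iff)
  qed
  ultimately show ?thesis by (simp add: bij_betw_def)
qed

lemma finite_lattice_bounded: "finite {w \<in> oct_lattice \<omega>. norm w \<le> R}"
proof -
  obtain c where c: "c > 0" "\<And>x h. c * \<bar>x $ h\<bar> \<le> norm (\<Phi> x)"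
    using lattice_norm_lower_bound by auto
  have "{w \<in> oct_lattice \<omega>. norm w \<le> R} \<subseteq> lattice_point ` PiE UNIV (\<lambda>_. {- \<lceil>R / c\<rceil>..\<lceil>R / c\<rceil>})"
  proof
    fix w assume w: "w \<in> {w \<in> oct_lattice \<omega>. norm w \<le> R}"
    then obtain k where k: "w = lattice_point k"
      using bij_betw_lattice_point by (auto simp: bij_betw_def)
    have "k h \<in> {- \<lceil>R / c\<rceil>..\<lceil>R / c\<rceil>}" for h
    proof -
      have "c * \<bar>of_int (k h)\<bar> \<le> R"
        using c(2)[of "\<chi> h. of_int (k h)" h] w by (simp add: k lattice_point_def)
      then have "of_int \<bar>k h\<bar> \<le> R / c" using c(1) by (simp add: field_simps)
      then have "\<bar>k h\<bar> \<le> \<lceil>R / c\<rceil>" by linarith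
      then show ?thesis by (auto simp: abs_le_iff)
    qed
    then show "w \<in> lattice_point ` PiE UNIV (\<lambda>_. {- \<lceil>R / c\<rceil>..\<lceil>R / c\<rceil>})"
      unfolding k by (intro imageI) auto
  qed
  then show ?thesis
    by (rule finite_subset) (intro finite_imageI finite_PiE; simp)
qed

text \<open>
  If \<open>\<bar>k h\<bar> \<le> m\<close> for all \<open>h\<close>, then \<open>(1 + m)\<^sup>-\<^sup>9\<close> is at most the product over the eight
  indices of \<open>(1 + \<bar>k h\<bar>)\<close> to the power \<open>- 9 / 8\<close>, and this product is summable.
\<close>

lemma summable_on_lattice_norm_power:
  "(\<lambda>w. 1 / norm w ^ 9) summable_on oct_lattice \<omega>"
proof -
  obtain c where c: "c > 0" "\<And>x h. c * \<bar>x $ h\<bar> \<le> norm (\<Phi> x)"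
    using lattice_norm_lower_bound by auto
  define P where "P k = (\<Prod>h\<in>UNIV. (1 + \<bar>of_int (k h)\<bar>) powr - (9/8 :: real))" for k :: "8 \<Rightarrow> int"
  have "P summable_on UNIV"
    unfolding P_def using summable_on_prod_fun[OF _ summable_on_abs_int_powr[of "9/8"]] by simp
  then have "(\<lambda>k. (2 / c) ^ 9 * P k) summable_on UNIV"
    by (rule summable_on_cmult_right)
  then have "(\<lambda>k. 1 / norm (lattice_point k) ^ 9) summable_on UNIV"
  proof (rule summable_on_comparison_test)
    fix k :: "8 \<Rightarrow> int"
    define m where "m = norm (lattice_point k) / c"
    have km: "\<bar>of_int (k h)\<bar> \<le> m" for h
      using c(2)[of "\<chi> h. of_int (k h)" h] c(1) by (simp add: m_def lattice_point_def field_simps)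
    show "1 / norm (lattice_point k) ^ 9 \<le> (2 / c) ^ 9 * P k"
    proof (cases "k = (\<lambda>_. 0)")
      case True
      then have "lattice_point k = 0"
        by (simp add: lattice_point_def \<Phi>_def)
      \<comment> \<open>Here the left side is \<open>1 / 0\<close>, which is
        \<open>0\<close>.\<close>
      then show ?thesis using c(1) by (auto simp: P_def intro!: mult_nonneg_nonneg prod_nonneg)
    next
      case False
      then obtain h where "k h \<noteq> 0" by auto
      then have "1 \<le> \<bar>of_int (k h) :: real\<bar>" by linarith
      \<comment> \<open>Hence \<open>1 + m \<le> 2 * m\<close>, which accounts for the 2 in the
        constant.\<close>
      then have m: "m \<ge> 1" using km[of h] by simp
      have "(1 + m) powr - 9 = (\<Prod>h\<in>(UNIV :: 8 set). (1 + m) powr - (9/8))"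
        using m by (simp add: powr_power)
      also have "\<dots> \<le> P k"
        unfolding P_def using km m by (intro prod_mono conjI powr_mono2') auto
      finally have P: "(1 + m) powr - 9 \<le> P k" .
      have "norm (lattice_point k) = c * m" using c(1) by (simp add: m_def)
      then have "1 / norm (lattice_point k) ^ 9 = (2 / c) ^ 9 * (1 / (2 * m) ^ 9)"
        using c(1) m by (simp add: field_simps)
      also have "\<dots> \<le> (2 / c) ^ 9 * (1 / (1 + m) ^ 9)"
        using c(1) m by (intro mult_left_mono divide_left_mono power_mono) auto
      also have "1 / (1 + m) ^ 9 = (1 + m) powr - 9"
        using m by (simp add: powr_minus_divide powr_numeral)
      also have "(2 / c) ^ 9 * (1 + m) powr - 9 \<le> (2 / c) ^ 9 * P k"
        using P c(1) by (intro mult_left_mono) auto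
      finally show ?thesis .
    qed
  qed auto
  then show ?thesis
    by (simp add: summable_on_reindex_bij_betw[OF bij_betw_lattice_point, of "\<lambda>w. 1 / norm w ^ 9"])
qed

text \<open>Only the tail counts: a ball contains finitely many lattice points, so small
  \<open>w\<close>, where the Taylor estimates do not apply, can be set aside.\<close>

lemma summable_on_latticeI:
  fixes f :: "octonion \<Rightarrow> 'b::banach"
  assumes "\<And>w. w \<in> oct_lattice \<omega> \<Longrightarrow> norm w > R \<Longrightarrow> norm (f w) \<le> C / norm w ^ 9"
  shows "f summable_on oct_lattice \<omega>"
proof -
  let ?A = "{w \<in> oct_lattice \<omega>. norm w \<le> R}" and ?B = "{w \<in> oct_lattice \<omega>. norm w > R}"
  have "(\<lambda>w. C * (1 / norm w ^ 9)) summable_on ?B"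
    by (intro summable_on_cmult_right summable_on_subset_banach[OF summable_on_lattice_norm_power]) auto
  then have "(\<lambda>w. norm (f w)) summable_on ?B"
    by (rule summable_on_comparison_test) (use assms in auto)
  then have "f summable_on ?B"
    by (rule abs_summable_summable)
  moreover have "f summable_on ?A"
    using finite_lattice_bounded by simp
  ultimately have "f summable_on ?A \<union> ?B"
    by (intro summable_on_Un_disjoint) auto
  moreover have "?A \<union> ?B = oct_lattice \<omega>" by auto
  ultimately show ?thesis by simp
qed

end

section \<open>Division points\<close>

lemma emeasure_fundamental_domains_eq:
  fixes A B G :: "'a::euclidean_space set"
  assumes G: "countable G" "\<And>g. g \<in> G \<Longrightarrow> - g \<in> G"
    and A: "A \<in> sets borel" "\<And>x. \<exists>!g\<in>G. x - g \<in> A"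
    and B: "B \<in> sets borel" "\<And>x. \<exists>!g\<in>G. x - g \<in> B"
  shows "emeasure lborel A = emeasure lborel B"
proof -
  \<comment> \<open>The translates of one domain cut the other into countably many pieces.\<close>
  have split: "emeasure lborel A = (\<integral>\<^sup>+g. emeasure lborel (A \<inter> {x. x - g \<in> B}) \<partial>count_space G)"
    if A: "A \<in> sets borel" and B: "B \<in> sets borel" "\<And>x. \<exists>!g\<in>G. x - g \<in> B" for A B
  proof -
    have [measurable]: "A \<in> sets borel" "B \<in> sets borel" by fact+
    have "A = (\<Union>g\<in>G. A \<inter> {x. x - g \<in> B})"
      using B(2) by blast
    moreover have "disjoint_family_on (\<lambda>g. A \<inter> {x. x - g \<in> B}) G"
      unfolding disjoint_family_on_def using B(2) by blast
    ultimately show ?thesis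
      using emeasure_UN_countable[of G "\<lambda>g. A \<inter> {x. x - g \<in> B}" lborel] G(1) by simp
  qed
  \<comment> \<open>Translation by \<open>- g\<close> carries the piece of \<open>A\<close> in
    \<open>B + g\<close> to the piece of \<open>B\<close> in \<open>A - g\<close>, so both domains
    consist of the same pieces up to translation.\<close>
  have shift: "emeasure lborel (A \<inter> {x. x - g \<in> B}) = emeasure lborel (B \<inter> {x. x - (- g) \<in> A})" for g
  proof -
    have [measurable]: "A \<in> sets borel" "B \<in> sets borel" by fact+
    have "emeasure lborel (A \<inter> {x. x - g \<in> B}) = emeasure (distr lborel borel ((+) g)) (A \<inter> {x. x - g \<in> B})"
      by (simp add: lborel_distr_plus)
    also have "\<dots> = emeasure lborel ((+) g -` (A \<inter> {x. x - g \<in> B}) \<inter> space lborel)"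
      by (rule emeasure_distr) measurable
    also have "(+) g -` (A \<inter> {x. x - g \<in> B}) \<inter> space lborel = B \<inter> {x. x - (- g) \<in> A}"
      by (auto simp: add.commute)
    finally show ?thesis .
  qed
  have "bij_betw uminus G G"
    by (rule bij_betw_byWitness[where f' = uminus]) (use G(2) in auto)
  then have "(\<integral>\<^sup>+g. emeasure lborel (B \<inter> {x. x - (- g) \<in> A}) \<partial>count_space G) =
      (\<integral>\<^sup>+g. emeasure lborel (B \<inter> {x. x - g \<in> A}) \<partial>count_space G)"
    by (rule nn_integral_bij_count_space)
  then show ?thesis
    using split[OF A(1) B] split[OF B(1) A] by (simp add: shift)
qed

lemma emeasure_lborel_translation:
  fixes A :: "'a::euclidean_space set"
  assumes "A \<in> sets borel"
  shows "emeasure lborel {x. x - a \<in> A} = emeasure lborel A"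
proof -
  have [measurable]: "A \<in> sets borel" by fact
  have "emeasure lborel {x. x - a \<in> A} = emeasure (distr lborel borel ((+) a)) {x. x - a \<in> A}"
    by (simp add: lborel_distr_plus)
  also have "\<dots> = emeasure lborel ((+) a -` {x. x - a \<in> A} \<inter> space lborel)"
    by (rule emeasure_distr) measurable
  also have "(+) a -` {x. x - a \<in> A} \<inter> space lborel = A" by auto
  finally show ?thesis .
qed

text \<open>Bijectivity makes the image a preimage under the inverse, which is linear and hence
  continuous.\<close>

lemma sets_borel_linear_image:
  fixes f :: "'a::euclidean_space \<Rightarrow> 'a"
  assumes "linear f" "bij f" "A \<in> sets borel"
  shows "f ` A \<in> sets borel"
proof -
  have "linear (inv f)"
    using assms(1) bij_is_inj[OF assms(2)] by (rule inj_linear_imp_inv_linear)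
  then have [measurable]: "inv f \<in> borel_measurable borel"
    by (intro borel_measurable_continuous_onI linear_continuous_on) (simp add: linear_conv_bounded_linear)
  have "f ` A = inv f -` A \<inter> space borel"
    using bij_image_Collect_eq[OF assms(2), of "\<lambda>x. x \<in> A"] by auto
  then show ?thesis
    using measurable_sets[OF \<open>inv f \<in> borel_measurable borel\<close> assms(3)] by (simp only:)
qed

text \<open>Dividing \<open>f\<close> by \<open>c\<close> leaves an orthogonal map, so the
  determinant of \<open>f\<close> is the power of \<open>c\<close> up to sign.\<close>

lemma measure_lborel_similarity_image:
  fixes f :: "real^'n::{finite,wellorder} \<Rightarrow> real^'n::_"
  assumes f: "linear f" and c: "c > 0" "\<And>x. norm (f x) = c * norm x"
    and A: "A \<in> sets borel" "bounded A"
  shows "measure lborel (f ` A) = c ^ CARD('n) * measure lborel A"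
proof -
  have "inj f"
    using c by (auto simp: linear_injective_0[OF f] dest: arg_cong[of _ _ norm])
  then have "bij f"
    using linear_injective_imp_surjective[OF f] by (simp add: bij_def)
  have "A \<in> lmeasurable"
    using A by (intro bounded_set_imp_lmeasurable) auto
  moreover have "orthogonal_transformation (\<lambda>x. (1 / c) *\<^sub>R f x)"
    unfolding orthogonal_transformation using c
    by (auto intro!: linear_compose_scale_right[OF f])
  then have "\<bar>det (matrix (\<lambda>x. (1 / c) *\<^sub>R f x))\<bar> = 1"
    by (rule orthogonal_transformation_det)
  moreover have "matrix f = c *\<^sub>R matrix (\<lambda>x. (1 / c) *\<^sub>R f x)"
    using c(1) by (simp add: matrix_def vec_eq_iff)
  then have "matrix f = (\<chi> i. c *s (matrix (\<lambda>x. (1 / c) *\<^sub>R f x)) $ i)"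
    by (simp add: vec_eq_iff)
  then have "det (matrix f) = c ^ CARD('n) * det (matrix (\<lambda>x. (1 / c) *\<^sub>R f x))"
    using det_rows_mul[of "\<lambda>_. c" "\<lambda>i. matrix (\<lambda>x. (1 / c) *\<^sub>R f x) $ i"] by simp
  ultimately have "measure lebesgue (f ` A) = c ^ CARD('n) * measure lebesgue A"
    using c(1) by (simp add: measure_linear_image[OF f] abs_mult)
  \<comment> \<open>Borel measurability of the image permits the return from Lebesgue measure to
    \<open>lborel\<close>.\<close>
  moreover have "f ` A \<in> sets borel"
    by (rule sets_borel_linear_image[OF f \<open>bij f\<close> A(1)])
  ultimately show ?thesis
    using A(1) by (simp add: measure_completion)
qed

context oct_lattice_basis
begin

lemma cell_borel: "fundamental_cell \<omega> \<in> sets borel"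
proof -
  have "{x::real^8. \<forall>h. 0 \<le> x $ h \<and> x $ h < 1} \<in> sets borel"
    by measurable
  then show ?thesis
    unfolding cell_eq_image by (intro sets_borel_linear_image linear_\<Phi> bij_\<Phi>)
qed

lemma bounded_cell: "bounded (fundamental_cell \<omega>)"
proof -
  have "{x::real^8. \<forall>h. 0 \<le> x $ h \<and> x $ h < 1} \<subseteq> cbox 0 1"
    by (auto simp: mem_box_cart less_imp_le)
  then show ?thesis
    unfolding cell_eq_image
    by (intro bounded_linear_image linear_\<Phi>[unfolded linear_conv_bounded_linear] bounded_subset[OF bounded_cbox])
qed

text \<open>Otherwise countably many null translates of the cell would cover the space.\<close>

lemma measure_cell_pos: "measure lborel (fundamental_cell \<omega>) > 0"
proof (rule ccontr)
  assume "\<not> ?thesis"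
  then have "measure lborel (fundamental_cell \<omega>) = 0"
    by (simp add: not_less measure_le_0_iff)
  \<comment> \<open>\<open>measure\<close> is \<open>0\<close> on sets of infinite measure as well;
    boundedness of the cell excludes this case.\<close>
  moreover have "emeasure lborel (fundamental_cell \<omega>) < \<infinity>"
    by (rule emeasure_bounded_finite[OF bounded_cell])
  ultimately have 0: "emeasure lborel (fundamental_cell \<omega>) = 0"
    by (simp add: emeasure_eq_ennreal_measure)
  have "{x. x - w \<in> fundamental_cell \<omega>} \<in> null_sets lborel" for w
  proof -
    have "{x. x - w \<in> fundamental_cell \<omega>} \<in> sets borel"
      using cell_borel by measurable
    then show ?thesis
      using 0 by (simp add: null_sets_def emeasure_lborel_translation cell_borel)
  qed
  then have "(\<Union>w\<in>oct_lattice \<omega>. {x. x - w \<in> fundamental_cell \<omega>}) \<in> null_sets lborel"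
    by (intro null_sets_UN' countable_lattice)
  moreover have "(\<Union>w\<in>oct_lattice \<omega>. {x. x - w \<in> fundamental_cell \<omega>}) = UNIV"
    using ex1_lattice_cell by blast
  ultimately show False
    by (simp add: null_sets_def emeasure_lborel_UNIV)
qed

lemma finite_lattice_preimage_bounded:
  fixes f :: "octonion \<Rightarrow> octonion"
  assumes "bounded A" "linear f" "inj f"
  shows "finite {v \<in> A. f v \<in> oct_lattice \<omega>}"
proof -
  obtain R where "\<And>x. x \<in> f ` A \<Longrightarrow> norm x \<le> R"
    using bounded_linear_image[OF assms(1), of f] assms(2) unfolding linear_conv_bounded_linear bounded_iff by blast
  then have "f ` {v \<in> A. f v \<in> oct_lattice \<omega>} \<subseteq> {w \<in> oct_lattice \<omega>. norm w \<le> R}"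
    by auto
  then show ?thesis
    using assms(3) finite_lattice_bounded by (meson finite_imageD finite_subset inj_on_subset subset_UNIV)
qed

end

section \<open>The similarity \<open>T\<close> and the number of division points\<close>

locale oct_lattice_multipliers = oct_lattice_basis +
  fixes lam \<mu> :: octonion
  assumes lam_nonzero: "lam \<noteq> 0" and mu_nonzero: "\<mu> \<noteq> 0"
    and mult_closed: "\<And>w. w \<in> oct_lattice \<omega> \<Longrightarrow> lam \<odot> (w \<odot> \<mu>) \<in> oct_lattice \<omega>"
begin

definition N :: real where "N = oct_N lam * oct_N \<mu>"

definition T :: "octonion \<Rightarrow> octonion" where "T z = lam \<odot> (z \<odot> \<mu>)"

lemma N_pos: "N > 0"
  using lam_nonzero mu_nonzero by (simp add: N_def oct_N_def)

lemma linear_T: "linear T"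
  unfolding T_def linear_conv_bounded_linear
  by (intro bounded_linear_compose[OF bounded_bilinear.bounded_linear_right[OF bounded_bilinear_oct_mult]]
      bounded_bilinear.bounded_linear_left[OF bounded_bilinear_oct_mult])

lemma inner_T: "T x \<bullet> T y = N * (x \<bullet> y)"
  by (simp add: T_def N_def inner_oct_mult_same_left inner_oct_mult_same_right)

lemma norm_T: "norm (T x) = sqrt N * norm x"
  by (simp add: norm_eq_sqrt_inner inner_T real_sqrt_mult)

lemma inj_T: "inj T"
  using N_pos by (auto simp: linear_injective_0[OF linear_T] norm_T dest: arg_cong[of _ _ norm])

lemma bij_T: "bij T"
  using inj_T linear_injective_imp_surjective[OF linear_T inj_T] by (simp add: bij_def)

lemma T_lattice: "w \<in> oct_lattice \<omega> \<Longrightarrow> T w \<in> oct_lattice \<omega>"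
  unfolding T_def by (rule mult_closed)

lemma T_eq_iff: "T v = w \<longleftrightarrow> v = (oct_inverse lam \<odot> w) \<odot> oct_inverse \<mu>"
  using oct_left_inverse_mult[OF lam_nonzero] oct_right_inverse_mult[OF mu_nonzero]
  by (auto simp: T_def)

lemma division_points_eq: "division_points \<omega> lam \<mu> = {v \<in> fundamental_cell \<omega>. T v \<in> oct_lattice \<omega>}"
  unfolding division_points_def T_eq_iff[symmetric] by auto

lemma finite_division_points: "finite (division_points \<omega> lam \<mu>)"
  unfolding division_points_eq by (rule finite_lattice_preimage_bounded[OF bounded_cell linear_T inj_T])

text \<open>\<open>T\<close> preserves the lattice, so subtracting a period keeps \<open>T l\<close>
  a lattice point, and reduction to the cell ends at a division point.\<close>

lemma ex1_division_point_lattice: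
  assumes "T l \<in> oct_lattice \<omega>"
  shows "\<exists>!w\<in>oct_lattice \<omega>. l - w \<in> division_points \<omega> lam \<mu>"
proof -
  have "T (l - w) \<in> oct_lattice \<omega>" if "w \<in> oct_lattice \<omega>" for w
    using assms that by (simp add: linear_diff[OF linear_T] lattice_diff T_lattice)
  then show ?thesis
    using ex1_lattice_cell[of l] by (auto simp: division_points_eq)
qed

text \<open>
  Both \<open>T F\<close> and the union of the cells \<open>T v + F\<close> over the division points \<open>v\<close> are
  fundamental domains of the lattice \<open>T \<Omega>\<close>.
\<close>

lemma card_division_points: "real (card (division_points \<omega> lam \<mu>)) = N ^ 4"
proof -
  let ?F = "fundamental_cell \<omega>" and ?V = "division_points \<omega> lam \<mu>" and ?\<Omega> = "oct_lattice \<omega>"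
  define B where "B = (\<Union>v\<in>?V. {x. x - T v \<in> ?F})"
  have F: "?F \<in> sets borel" by (rule cell_borel)
  have F': "{x. x - a \<in> ?F} \<in> sets borel" for a using F by measurable
  have B: "B \<in> sets borel"
    unfolding B_def using F' finite_division_points by (intro sets.finite_UN) auto
  have "emeasure lborel (T ` ?F) = emeasure lborel B"
  proof (rule emeasure_fundamental_domains_eq[where G = "T ` ?\<Omega>"])
    show "countable (T ` ?\<Omega>)" using countable_lattice by simp
    show "- g \<in> T ` ?\<Omega>" if "g \<in> T ` ?\<Omega>" for g
      using that lattice_minus by (auto simp: linear_neg[OF linear_T, symmetric])
    show "T ` ?F \<in> sets borel"
      by (rule sets_borel_linear_image[OF linear_T bij_T F])
    show "B \<in> sets borel" by fact
    fix x
    obtain y where y: "x = T y" using bij_T by (metis bij_pointE)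
    have "T y - T w \<in> T ` ?F \<longleftrightarrow> y - w \<in> ?F" for w
      using inj_T by (simp add: linear_diff[OF linear_T, symmetric] inj_image_mem_iff)
    then show "\<exists>!g\<in>T ` ?\<Omega>. x - g \<in> T ` ?F"
      using ex1_lattice_cell[of y] unfolding y by fast
    \<comment> \<open>Reduce \<open>x\<close> by a period \<open>u\<close>, then the preimage
      \<open>l\<close> of \<open>u\<close> under \<open>T\<close> by a period \<open>w\<close>. The
      remainder \<open>l - w\<close> is a division point, so \<open>T w\<close> is the required
      translation.\<close>
    obtain u where u: "u \<in> ?\<Omega>" "x - u \<in> ?F" and uu: "\<And>u'. u' \<in> ?\<Omega> \<Longrightarrow> x - u' \<in> ?F \<Longrightarrow> u' = u"
      using ex1_lattice_cell[of x] by blast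
    obtain l where l: "u = T l" using bij_T by (metis bij_pointE)
    obtain w where w: "w \<in> ?\<Omega>" "l - w \<in> ?V" and ww: "\<And>w'. w' \<in> ?\<Omega> \<Longrightarrow> l - w' \<in> ?V \<Longrightarrow> w' = w"
      using ex1_division_point_lattice[of l] u(1) l by blast
    show "\<exists>!g\<in>T ` ?\<Omega>. x - g \<in> B"
    proof (rule ex1I[of _ "T w"])
      have "x - T w - T (l - w) \<in> ?F"
        using u(2) by (simp add: l linear_diff[OF linear_T])
      then show "T w \<in> T ` ?\<Omega> \<and> x - T w \<in> B"
        using w unfolding B_def by blast
      fix g assume "g \<in> T ` ?\<Omega> \<and> x - g \<in> B"
      then obtain w' v where w': "g = T w'" "w' \<in> ?\<Omega>" and v: "v \<in> ?V" "x - g - T v \<in> ?F"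
        unfolding B_def by blast
      have "x - (T w' + T v) \<in> ?F" using v w' by (simp add: algebra_simps)
      moreover have "T w' + T v \<in> ?\<Omega>"
        using v w' by (auto simp: division_points_eq intro: lattice_add T_lattice)
      ultimately have "T (w' + v) = T l"
        using uu l by (simp add: linear_add[OF linear_T])
      then have "w' + v = l" using inj_T by (simp add: inj_eq)
      then have "l - w' = v" by auto
      then show "g = T w" using ww[OF w'(2)] v(1) w'(1) by simp
    qed
  qed
  also have "emeasure lborel B = (\<Sum>v\<in>?V. emeasure lborel {x. x - T v \<in> ?F})"
    unfolding B_def
  proof (rule sum_emeasure[symmetric])
    show "(\<lambda>v. {x. x - T v \<in> ?F}) ` ?V \<subseteq> sets lborel" using F' by auto
    \<comment> \<open>Distinct division points have distinct lattice points as images, and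
      translates of the cell by distinct lattice points are disjoint.\<close>
    show "disjoint_family_on (\<lambda>v. {x. x - T v \<in> ?F}) ?V"
      unfolding disjoint_family_on_def
    proof (intro ballI impI, rule ccontr)
      fix v v' assume v: "v \<in> ?V" "v' \<in> ?V" "v \<noteq> v'"
        and "{x. x - T v \<in> ?F} \<inter> {x. x - T v' \<in> ?F} \<noteq> {}"
      then obtain x where "x - T v \<in> ?F" "x - T v' \<in> ?F" by blast
      moreover have "T v \<in> ?\<Omega>" "T v' \<in> ?\<Omega>" using v by (auto simp: division_points_eq)
      ultimately have "T v = T v'" using ex1_lattice_cell[of x] by blast
      then show False using v(3) inj_T by (simp add: inj_eq)
    qed
  qed (rule finite_division_points)
  also have "\<dots> = of_nat (card ?V) * emeasure lborel ?F"
    by (simp add: emeasure_lborel_translation[OF F])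
  finally have "measure lborel (T ` ?F) = real (card ?V) * measure lborel ?F"
    by (simp add: measure_def enn2real_mult)
  \<comment> \<open>The ratio \<open>sqrt N\<close> in dimension 8 is the source of the fourth power
    of \<open>N\<close>.\<close>
  moreover have "measure lborel (T ` ?F) = sqrt N ^ 8 * measure lborel ?F"
    using measure_lborel_similarity_image[OF linear_T _ _ F bounded_cell, of "sqrt N"] N_pos norm_T by simp
  moreover have "sqrt N ^ 8 = N ^ 4"
    using N_pos power_mult[of "sqrt N" 2 4] by simp
  ultimately show ?thesis
    using measure_cell_pos by simp
qed

end

section \<open>The zeta function\<close>

definition zeta_term :: "octonion \<Rightarrow> octonion \<Rightarrow> octonion" where
  "zeta_term z w = q0 (z + w) - q0 w - Dq0 w z"

text \<open>Moves the expansion point from \<open>v + w\<close> to \<open>w\<close>. Each of the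
  three parts on the right is summable over the lattice in \<open>w\<close>, so sums over a coset
  reduce to sums over the lattice.\<close>

lemma zeta_term_add:
  "zeta_term z (v + w) = zeta_term (z + v) w - zeta_term v w - (Dq0 (v + w) z - Dq0 w z)"
  by (simp add: zeta_term_def linear_simps(1)[OF bounded_linear_Dq0] add.assoc)

context oct_lattice_basis
begin

text \<open>The sum with \<open>V\<tau>\<close> is \<open>Dq0 w z\<close>, and the Taylor estimate
  gives convergence. As \<open>q0 0 = 0\<close>, this holds for every \<open>z\<close>, lattice
  points included.\<close>

lemma has_sum_oct_zeta: "(zeta_term z has_sum oct_zeta \<omega> z) (oct_lattice \<omega>)"
proof -
  have "zeta_term z summable_on oct_lattice \<omega>"
  proof (rule summable_on_latticeI)
    fix w :: octonion assume w: "2 * norm z < norm w"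
    then have "w \<noteq> 0" using norm_ge_zero[of z] by auto
    with w show "norm (zeta_term z w) \<le> 108544 * (norm z)\<^sup>2 / norm w ^ 9"
      using norm_q0_Taylor_le[of w z] by (auto simp: zeta_term_def add.commute)
  qed
  then have "zeta_term z summable_on oct_lattice \<omega> - {0}"
    by (rule summable_on_cofin_subset) simp
  then have "(zeta_term z has_sum infsum (zeta_term z) (oct_lattice \<omega> - {0})) (oct_lattice \<omega> - {0})"
    by (rule has_sum_infsum)
  then have "(zeta_term z has_sum (zeta_term z 0 + infsum (zeta_term z) (oct_lattice \<omega> - {0})))
      (insert 0 (oct_lattice \<omega> - {0}))"
    by (intro has_sum_insert) auto
  then have "(zeta_term z has_sum (zeta_term z 0 + infsum (zeta_term z) (oct_lattice \<omega> - {0}))) (oct_lattice \<omega>)"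
    by (simp only: insert_Diff[OF lattice_0])
  moreover have "zeta_term z w = q0 (z + w) - q0 w - (\<Sum>j\<in>UNIV - {0}. V\<tau> j z \<odot> q\<tau> j w)"
    if "w \<noteq> 0" for w
    using sum_V\<tau>_Dq0[of z w] by (simp add: zeta_term_def q\<tau>_eq_Dq0[OF that])
  then have "infsum (zeta_term z) (oct_lattice \<omega> - {0}) =
      (\<Sum>\<^sub>\<infinity>w\<in>oct_lattice \<omega> - {0}. q0 (z + w) - q0 w - (\<Sum>j\<in>UNIV - {0}. V\<tau> j z \<odot> q\<tau> j w))"
    by (intro infsum_cong) auto
  then have "zeta_term z 0 + infsum (zeta_term z) (oct_lattice \<omega> - {0}) = oct_zeta \<omega> z"
    unfolding oct_zeta_def by (simp add: zeta_term_def)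
  ultimately show ?thesis by simp
qed

text \<open>The map \<open>P\<^sub>v\<close> of the overview: formally, the term-by-term derivative
  of the zeta function at \<open>v\<close> in direction \<open>z\<close>.\<close>

definition Dzeta_at :: "octonion \<Rightarrow> octonion \<Rightarrow> octonion" where
  "Dzeta_at v z = (\<Sum>\<^sub>\<infinity>w\<in>oct_lattice \<omega>. Dq0 (v + w) z - Dq0 w z)"

lemma has_sum_Dzeta_at: "((\<lambda>w. Dq0 (v + w) z - Dq0 w z) has_sum Dzeta_at v z) (oct_lattice \<omega>)"
  unfolding Dzeta_at_def
proof (rule has_sum_infsum, rule summable_on_latticeI)
  fix w :: octonion assume w: "2 * norm v < norm w"
  then have "w \<noteq> 0" using norm_ge_zero[of v] by auto
  with w show "norm (Dq0 (v + w) z - Dq0 w z) \<le> (108544 * norm v * norm z) / norm w ^ 9"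
    using norm_Dq0_diff_le[of w v z] by (auto simp: add.commute)
qed

lemma linear_Dzeta_at: "linear (Dzeta_at v)"
proof (rule linearI)
  fix x y :: octonion and c :: real
  have "((\<lambda>w. Dq0 (v + w) (x + y) - Dq0 w (x + y)) has_sum Dzeta_at v x + Dzeta_at v y) (oct_lattice \<omega>)"
    using has_sum_add[OF has_sum_Dzeta_at[of v x] has_sum_Dzeta_at[of v y]]
    by (simp add: linear_simps(1)[OF bounded_linear_Dq0] algebra_simps)
  then show "Dzeta_at v (x + y) = Dzeta_at v x + Dzeta_at v y"
    by (rule has_sum_unique[OF has_sum_Dzeta_at])
  have "((\<lambda>w. Dq0 (v + w) (c *\<^sub>R x) - Dq0 w (c *\<^sub>R x)) has_sum c *\<^sub>R Dzeta_at v x) (oct_lattice \<omega>)"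
    using has_sum_scaleR[OF has_sum_Dzeta_at[of v x], of c]
    by (simp add: linear_simps(5)[OF bounded_linear_Dq0] scaleR_diff_right)
  then show "Dzeta_at v (c *\<^sub>R x) = c *\<^sub>R Dzeta_at v x"
    by (rule has_sum_unique[OF has_sum_Dzeta_at])
qed

lemma Dzeta_at_0 [simp]: "Dzeta_at 0 z = 0"
  by (simp add: Dzeta_at_def)

lemma wp\<tau>_eq_Dzeta_at:
  assumes "v \<notin> oct_lattice \<omega>"
  shows "wp\<tau> i \<omega> v = Dzeta_at v (oct_e i)"
proof -
  let ?f = "\<lambda>w. Dq0 (v + w) (oct_e i) - Dq0 w (oct_e i)"
  \<comment> \<open>Off the lattice no shifted argument vanishes, so \<open>q\<tau>\<close> and
    \<open>Dq0\<close> agree in every term.\<close>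
  have nz: "v + w \<noteq> 0" if "w \<in> oct_lattice \<omega>" for w
    using assms lattice_minus[OF that] by (auto simp: add_eq_0_iff2)
  have "?f summable_on oct_lattice \<omega> - {0}"
    using has_sum_imp_summable[OF has_sum_Dzeta_at] by (rule summable_on_cofin_subset) simp
  then have "(?f has_sum (?f 0 + infsum ?f (oct_lattice \<omega> - {0}))) (insert 0 (oct_lattice \<omega> - {0}))"
    by (intro has_sum_insert has_sum_infsum) auto
  then have "(?f has_sum (?f 0 + infsum ?f (oct_lattice \<omega> - {0}))) (oct_lattice \<omega>)"
    by (simp only: insert_Diff[OF lattice_0])
  with has_sum_Dzeta_at have "Dzeta_at v (oct_e i) = ?f 0 + infsum ?f (oct_lattice \<omega> - {0})"
    by (rule has_sum_unique)
  also have "infsum ?f (oct_lattice \<omega> - {0}) = (\<Sum>\<^sub>\<infinity>w\<in>oct_lattice \<omega> - {0}. q\<tau> i (v + w) - q\<tau> i w)"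
    by (rule infsum_cong) (simp add: q\<tau>_eq_Dq0 nz)
  also have "?f 0 + \<dots> = wp\<tau> i \<omega> v"
    using nz[OF lattice_0] by (simp add: wp\<tau>_def q\<tau>_eq_Dq0)
  finally show ?thesis ..
qed

lemma has_sum_zeta_term_coset:
  "(zeta_term z has_sum (oct_zeta \<omega> (z + v) - oct_zeta \<omega> v - Dzeta_at v z)) ((+) v ` oct_lattice \<omega>)"
proof (subst has_sum_reindex)
  have "((\<lambda>w. - zeta_term v w) has_sum - oct_zeta \<omega> v) (oct_lattice \<omega>)"
    "((\<lambda>w. - (Dq0 (v + w) z - Dq0 w z)) has_sum - Dzeta_at v z) (oct_lattice \<omega>)"
    unfolding has_sum_uminus minus_minus by (rule has_sum_oct_zeta has_sum_Dzeta_at)+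
  then have "((\<lambda>w. zeta_term (z + v) w + - zeta_term v w + - (Dq0 (v + w) z - Dq0 w z)) has_sum
      (oct_zeta \<omega> (z + v) + - oct_zeta \<omega> v + - Dzeta_at v z)) (oct_lattice \<omega>)"
    by (intro has_sum_add has_sum_oct_zeta)
  moreover have "zeta_term z \<circ> (+) v =
      (\<lambda>w. zeta_term (z + v) w + - zeta_term v w + - (Dq0 (v + w) z - Dq0 w z))"
    by (simp add: fun_eq_iff zeta_term_add)
  ultimately show "(zeta_term z \<circ> (+) v has_sum (oct_zeta \<omega> (z + v) - oct_zeta \<omega> v - Dzeta_at v z)) (oct_lattice \<omega>)"
    by simp
qed simp

lemma oct_zeta_quasiperiodic:
  assumes \<eta>: "legendre_constants \<omega> \<eta>" and z: "z \<notin> oct_lattice \<omega>"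
  shows "oct_zeta \<omega> (z + (\<Sum>j\<in>UNIV. of_int (k j) *\<^sub>R \<omega> j)) = oct_zeta \<omega> z + (\<Sum>j\<in>UNIV. of_int (k j) *\<^sub>R \<eta> j)"
proof -
  \<comment> \<open>The pairs satisfying \<open>?per\<close> form a group. Its first conjunct keeps
    shifted arguments off the lattice, where the Legendre relation applies.\<close>
  let ?per = "\<lambda>w e. w \<in> oct_lattice \<omega> \<and> (\<forall>z. z \<notin> oct_lattice \<omega> \<longrightarrow> oct_zeta \<omega> (z + w) = oct_zeta \<omega> z + e)"
  have off: "z + w \<notin> oct_lattice \<omega>" if "z \<notin> oct_lattice \<omega>" "w \<in> oct_lattice \<omega>" for z w
    using that lattice_diff[of "z + w" w] by auto
  have 0: "?per 0 0" by (simp add: lattice_0)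
  have basis: "?per (\<omega> h) (\<eta> h)" for h
    using \<eta> lattice_basis by (auto simp: legendre_constants_def algebra_simps)
  have add: "?per (w + w') (e + e')" if "?per w e" "?per w' e'" for w w' e e'
    using that off by (auto simp: lattice_add simp flip: add.assoc)
  have minus: "?per (- w) (- e)" if w: "?per w e" for w e
  proof (intro conjI allI impI)
    show "- w \<in> oct_lattice \<omega>" using w lattice_minus by blast
    fix z assume "z \<notin> oct_lattice \<omega>"
    then have "z + - w \<notin> oct_lattice \<omega>" using off w lattice_minus by blast
    then have "oct_zeta \<omega> (z + - w + w) = oct_zeta \<omega> (z + - w) + e" using w by blast
    then show "oct_zeta \<omega> (z + - w) = oct_zeta \<omega> z + - e" by simp
  qed
  have nat_mult: "?per (real m *\<^sub>R \<omega> h) (real m *\<^sub>R \<eta> h)" for m :: nat and h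
  proof (induction m)
    case (Suc m)
    show ?case
      unfolding of_nat_Suc scaleR_add_left scaleR_one by (rule add[OF basis Suc])
  qed (use 0 in simp)
  have int_mult: "?per (of_int (k h) *\<^sub>R \<omega> h) (of_int (k h) *\<^sub>R \<eta> h)" for h
  proof (cases "k h \<ge> 0")
    case True
    then show ?thesis using nat_mult[of "nat (k h)" h] by simp
  next
    case False
    then show ?thesis using minus[OF nat_mult[of "nat (- k h)" h]] by simp
  qed
  have "?per (\<Sum>j\<in>S. of_int (k j) *\<^sub>R \<omega> j) (\<Sum>j\<in>S. of_int (k j) *\<^sub>R \<eta> j)" if "finite S" for S
    using that
  proof (induction S)
    case (insert h S)
    show ?case
      unfolding sum.insert[OF insert.hyps] by (rule add[OF int_mult insert.IH])
  qed (use 0 in simp)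
  then show ?thesis using z by simp
qed

lemma det_period_matrix_nonzero: "det (period_matrix \<omega>) \<noteq> 0"
proof -
  have "matrix \<Phi> = transpose (period_matrix \<omega>)"
    by (simp add: matrix_def transpose_def period_matrix_def vec_eq_iff \<Phi>_axis)
  then show ?thesis
    using det_nz_iff_inj[OF linear_\<Phi>] inj_\<Phi> by (simp add: det_transpose)
qed

text \<open>Component \<open>l\<close> is column \<open>l\<close> expanded with the cofactors of
  column \<open>i\<close>. A linear map known at the periods is thereby known at
  \<open>oct_e i\<close>.\<close>

lemma sum_cofactor_basis:
  "(\<Sum>h\<in>UNIV. cofactor (period_matrix \<omega>) h i *\<^sub>R \<omega> h) = det (period_matrix \<omega>) *\<^sub>R oct_e i"
proof -
  have "(\<Sum>h\<in>UNIV. cofactor (period_matrix \<omega>) h i * \<omega> h $ l) = (if l = i then det (period_matrix \<omega>) else 0)" for l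
    using sum_cofactor[of "period_matrix \<omega>" l i] by (simp add: period_matrix_def mult.commute)
  then show ?thesis
    by (auto simp: vec_eq_iff oct_e_def axis_def)
qed

end

section \<open>Transformation of the zeta function under \<open>T\<close>\<close>

context oct_lattice_multipliers
begin

text \<open>The bracketing is that of \<open>oct_bracketing\<close>, which yields one factor
  \<open>N\<close>. With the cube this makes \<open>N ^ 4\<close>, cancelling the factor by which
  \<open>T\<close> scales the eighth power of the norm in \<open>q0\<close>.\<close>

definition K :: "octonion \<Rightarrow> octonion" where
  "K x = N ^ 3 *\<^sub>R (\<mu> \<odot> (x \<odot> lam))"

lemma bounded_linear_K: "bounded_linear K"
  unfolding K_def
  by (intro bounded_linear_compose[OF bounded_linear_scaleR_right]
      bounded_linear_compose[OF bounded_bilinear.bounded_linear_right[OF bounded_bilinear_oct_mult]]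
      bounded_bilinear.bounded_linear_left[OF bounded_bilinear_oct_mult])

lemma K_conj_T: "K (oct_conj (T z)) = N ^ 4 *\<^sub>R oct_conj z"
  using oct_bracketing[of \<mu> lam z] by (simp add: K_def T_def N_def power_numeral_reduce)

lemma norm_T_power: "norm (T z) ^ (2 * k) = N ^ k * norm z ^ (2 * k)"
  using N_pos by (simp add: norm_T power_mult_distrib power_mult)

lemma K_q0_T: "K (q0 (T z)) = q0 z"
  using norm_T_power[of z 4] N_pos
  by (simp add: q0_def linear_simps(5)[OF bounded_linear_K] K_conj_T)

text \<open>The chain rule for \<open>K_q0_T\<close>, verified on the formula so as to include
  \<open>w = 0\<close>. In the second part, \<open>N\<close> from the inner product and
  \<open>N ^ 4\<close> from \<open>K\<close> balance \<open>N ^ 5\<close> from the tenth power of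
  the norm.\<close>

lemma K_Dq0_T: "K (Dq0 (T w) (T z)) = Dq0 w z"
proof -
  have p: "norm (T w) ^ 8 = N ^ 4 * norm w ^ 8" "norm (T w) ^ 10 = N ^ 5 * norm w ^ 10"
    using norm_T_power[of w 4] norm_T_power[of w 5] by simp_all
  have "8 * (N * (w \<bullet> z)) / (N ^ 5 * norm w ^ 10) * N ^ 4 = 8 * (w \<bullet> z) / norm w ^ 10"
    using N_pos by (cases "w = 0") (simp_all add: field_simps power_numeral_reduce)
  then show ?thesis
    using N_pos by (simp add: Dq0_def linear_simps(2,5)[OF bounded_linear_K] K_conj_T inner_T p)
qed

lemma K_zeta_term_T: "K (zeta_term (T z) (T l)) = zeta_term z l"
  by (simp add: zeta_term_def linear_simps(2)[OF bounded_linear_K] K_q0_T K_Dq0_T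
      flip: linear_add[OF linear_T])

lemma preimage_eq_cosets:
  "T -` oct_lattice \<omega> = (\<Union>v\<in>division_points \<omega> lam \<mu>. (+) v ` oct_lattice \<omega>)"
proof (intro set_eqI iffI)
  fix l assume "l \<in> T -` oct_lattice \<omega>"
  then obtain w where "w \<in> oct_lattice \<omega>" "l - w \<in> division_points \<omega> lam \<mu>"
    using ex1_division_point_lattice[of l] by auto
  moreover have "l = (l - w) + w" by simp
  ultimately show "l \<in> (\<Union>v\<in>division_points \<omega> lam \<mu>. (+) v ` oct_lattice \<omega>)" by blast
next
  fix l assume "l \<in> (\<Union>v\<in>division_points \<omega> lam \<mu>. (+) v ` oct_lattice \<omega>)"
  then show "l \<in> T -` oct_lattice \<omega>"
    by (auto simp: division_points_eq linear_add[OF linear_T] intro!: lattice_add intro: T_lattice)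
qed

lemma division_point_cosets_disjoint:
  assumes "v \<in> division_points \<omega> lam \<mu>" "v' \<in> division_points \<omega> lam \<mu>" "v \<noteq> v'"
  shows "(+) v ` oct_lattice \<omega> \<inter> (+) v' ` oct_lattice \<omega> = {}"
proof (rule ccontr)
  assume "\<not> ?thesis"
  then obtain w w' where w: "w \<in> oct_lattice \<omega>" "w' \<in> oct_lattice \<omega>" "v + w = v' + w'" by blast
  \<comment> \<open>Both \<open>v\<close> and \<open>v'\<close> would represent the same point in
    the cell.\<close>
  have "v + w - w \<in> fundamental_cell \<omega>" "v + w - w' \<in> fundamental_cell \<omega>"
    using assms(1,2) unfolding division_points_eq by (simp, unfold w(3), simp)
  then have "w = w'" using ex1_lattice_cell[of "v + w"] w(1,2) by blast
  then show False using w(3) assms(3) by simp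
qed

text \<open>Both sides sum \<open>zeta_term z\<close> over the preimage of the lattice under
  \<open>T\<close>: the left after reindexing along \<open>T\<close>, the right coset by
  coset.\<close>

lemma K_oct_zeta_T:
  "K (oct_zeta \<omega> (T z)) =
    (\<Sum>v\<in>division_points \<omega> lam \<mu>. oct_zeta \<omega> (z + v) - oct_zeta \<omega> v - Dzeta_at v z)"
proof -
  have "((\<lambda>w. K (zeta_term (T z) w)) has_sum K (oct_zeta \<omega> (T z))) (oct_lattice \<omega>)"
    by (rule has_sum_bounded_linear[OF bounded_linear_K has_sum_oct_zeta])
  also have "oct_lattice \<omega> = T ` (T -` oct_lattice \<omega>)"
    using bij_T by (simp add: bij_is_surj surj_image_vimage_eq)
  also have "((\<lambda>w. K (zeta_term (T z) w)) has_sum K (oct_zeta \<omega> (T z))) (T ` (T -` oct_lattice \<omega>)) \<longleftrightarrow>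
      (zeta_term z has_sum K (oct_zeta \<omega> (T z))) (T -` oct_lattice \<omega>)"
    by (subst has_sum_reindex[OF inj_on_subset[OF inj_T subset_UNIV]]) (simp add: o_def K_zeta_term_T)
  finally have "(zeta_term z has_sum K (oct_zeta \<omega> (T z))) (T -` oct_lattice \<omega>)" .
  moreover have "(zeta_term z has_sum (\<Sum>v\<in>division_points \<omega> lam \<mu>.
      oct_zeta \<omega> (z + v) - oct_zeta \<omega> v - Dzeta_at v z)) (T -` oct_lattice \<omega>)"
    unfolding preimage_eq_cosets
    by (intro sum_has_sum finite_division_points has_sum_zeta_term_coset division_point_cosets_disjoint)
  ultimately show ?thesis by (rule has_sum_unique)
qed

text \<open>A countable lattice is a null set and cannot fill the space.\<close>

lemma ex_not_T_lattice: "\<exists>z. T z \<notin> oct_lattice \<omega>"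
proof (rule ccontr)
  assume "\<not> ?thesis"
  then have "oct_lattice \<omega> = UNIV" using bij_T by (metis UNIV_eq_I bij_pointE)
  then have "(UNIV :: octonion set) \<in> null_sets lborel"
    using countable_imp_null_set_lborel[OF countable_lattice] by simp
  then show False by (simp add: null_sets_def emeasure_lborel_UNIV)
qed

text \<open>Subtract the identity for \<open>K (oct_zeta \<omega> (T z))\<close> at \<open>z\<close>
  from that at \<open>z + \<omega> h\<close>: \<open>T\<close> moves the argument by an integer
  combination of periods on the left, and each summand on the right moves by one period.\<close>

lemma K_legendre:
  assumes \<eta>: "legendre_constants \<omega> \<eta>"
    and n: "T (\<omega> h) = (\<Sum>j\<in>UNIV. of_int (n j) *\<^sub>R \<omega> j)"
  shows "K (\<Sum>j\<in>UNIV. of_int (n j) *\<^sub>R \<eta> j) =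
    N ^ 4 *\<^sub>R \<eta> h - (\<Sum>v\<in>division_points \<omega> lam \<mu>. Dzeta_at v (\<omega> h))"
proof -
  let ?V = "division_points \<omega> lam \<mu>"
  obtain z where z: "T z \<notin> oct_lattice \<omega>" using ex_not_T_lattice by blast
  have zv: "z + v \<notin> oct_lattice \<omega>" if "v \<in> ?V" for v
  proof
    assume "z + v \<in> oct_lattice \<omega>"
    then have "T (z + v) - T v \<in> oct_lattice \<omega>"
      using that unfolding division_points_eq by (intro lattice_diff T_lattice[of "z + v"]) auto
    then show False using z by (simp add: linear_add[OF linear_T])
  qed
  have "K (\<Sum>j\<in>UNIV. of_int (n j) *\<^sub>R \<eta> j) = K (oct_zeta \<omega> (T (z + \<omega> h))) - K (oct_zeta \<omega> (T z))"
    using oct_zeta_quasiperiodic[OF \<eta> z]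
    by (simp add: linear_add[OF linear_T] n linear_simps(1)[OF bounded_linear_K])
  \<comment> \<open>The constants \<open>oct_zeta \<omega> v\<close> cancel, and by linearity only
    the value of \<open>Dzeta_at v\<close> at the period remains.\<close>
  also have "\<dots> = (\<Sum>v\<in>?V. (oct_zeta \<omega> (z + \<omega> h + v) - oct_zeta \<omega> (z + v)) - Dzeta_at v (\<omega> h))"
    unfolding K_oct_zeta_T sum_subtractf[symmetric]
    by (intro sum.cong refl) (simp add: linear_add[OF linear_Dzeta_at])
  also have "\<dots> = (\<Sum>v\<in>?V. \<eta> h - Dzeta_at v (\<omega> h))"
  proof (intro sum.cong refl)
    fix v assume "v \<in> ?V"
    then have "oct_zeta \<omega> (z + v + \<omega> h) - oct_zeta \<omega> (z + v) = \<eta> h"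
      using \<eta> zv unfolding legendre_constants_def by blast
    then show "oct_zeta \<omega> (z + \<omega> h + v) - oct_zeta \<omega> (z + v) - Dzeta_at v (\<omega> h) = \<eta> h - Dzeta_at v (\<omega> h)"
      by (simp add: add.commute add.left_commute)
  qed
  also have "\<dots> = N ^ 4 *\<^sub>R \<eta> h - (\<Sum>v\<in>?V. Dzeta_at v (\<omega> h))"
    by (simp add: sum_subtractf sum_constant_scaleR card_division_points del: sum_constant)
  finally show ?thesis .
qed

text \<open>The cell meets the lattice only in \<open>0\<close>, so the other division points are no
  poles, and the point \<open>0\<close> contributes \<open>Dzeta_at 0 = 0\<close> on the
  right.\<close>

lemma sum_wp\<tau>_eq:
  "(\<Sum>v\<in>division_points \<omega> lam \<mu> - {0}. wp\<tau> i \<omega> v) = (\<Sum>v\<in>division_points \<omega> lam \<mu>. Dzeta_at v (oct_e i))"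
proof -
  let ?V = "division_points \<omega> lam \<mu>"
  have "v \<notin> oct_lattice \<omega>" if v: "v \<in> ?V - {0}" for v
  proof
    assume "v \<in> oct_lattice \<omega>"
    moreover have "v - 0 \<in> fundamental_cell \<omega>" "v - v \<in> fundamental_cell \<omega>"
      using v cell_eq_image by (auto simp: division_points_eq intro!: image_eqI[of _ _ 0] simp: linear_0[OF linear_\<Phi>])
    ultimately have "v = 0"
      using ex1_lattice_cell[of v] lattice_0 by blast
    then show False using v by simp
  qed
  then have "(\<Sum>v\<in>?V - {0}. wp\<tau> i \<omega> v) = (\<Sum>v\<in>?V - {0}. Dzeta_at v (oct_e i))"
    by (intro sum.cong refl wp\<tau>_eq_Dzeta_at)
  also have "\<dots> = (\<Sum>v\<in>?V. Dzeta_at v (oct_e i))"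
    by (rule sum.mono_neutral_left) (auto simp: finite_division_points)
  finally show ?thesis .
qed

end

section \<open>Elimination by cofactors\<close>

theorem theorem4p14:
  fixes \<omega> \<eta> :: "8 \<Rightarrow> octonion" and lam \<mu> :: octonion and n :: "8 \<Rightarrow> 8 \<Rightarrow> int" and i :: 8
  assumes omega_0: "\<omega> 0 = oct_e 0"
    and lin_indep: "inj \<omega>" "independent (range \<omega>)"
    and lambda: "lam \<notin> range oct_of_real" "\<forall>w\<in>oct_lattice \<omega>. lam \<odot> w \<in> oct_lattice \<omega>"
    and mu: "\<mu> \<notin> range oct_of_real" "\<forall>w\<in>oct_lattice \<omega>. w \<odot> \<mu> \<in> oct_lattice \<omega>"
    and n: "\<And>h. lam \<odot> (\<omega> h \<odot> \<mu>) = (\<Sum>j\<in>UNIV. of_int (n h j) *\<^sub>R \<omega> j)"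
    and eta: "legendre_constants \<omega> \<eta>"
    and i: "i \<noteq> 0"
  shows "(\<Sum>v\<in>division_points \<omega> lam \<mu> - {0}. wp\<tau> i \<omega> v) =
    - ((oct_N lam * oct_N \<mu>) ^ 3 / det (period_matrix \<omega>)) *\<^sub>R
      ((\<Sum>h\<in>UNIV. cofactor (period_matrix \<omega>) h i *\<^sub>R
          (\<mu> \<odot> ((\<Sum>j\<in>UNIV. of_int (n h j) *\<^sub>R \<eta> j) \<odot> lam)))
       - (oct_N lam * oct_N \<mu>) *\<^sub>R (\<Sum>h\<in>UNIV. cofactor (period_matrix \<omega>) h i *\<^sub>R \<eta> h))"
proof -
  have "oct_of_real 0 = 0" by (simp add: oct_of_real_def)
  then have "lam \<noteq> 0" "\<mu> \<noteq> 0" using lambda(1) mu(1) by (metis rangeI)+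
  then interpret oct_lattice_multipliers \<omega> lam \<mu>
    using lin_indep lambda(2) mu(2) by unfold_locales auto
  let ?c = "\<lambda>h. cofactor (period_matrix \<omega>) h i" and ?d = "det (period_matrix \<omega>)"
    and ?V = "division_points \<omega> lam \<mu>"
  let ?x = "\<lambda>h. \<Sum>j\<in>UNIV. of_int (n h j) *\<^sub>R \<eta> j"
  let ?A = "\<Sum>h\<in>UNIV. ?c h *\<^sub>R (\<mu> \<odot> (?x h \<odot> lam))" and ?B = "\<Sum>h\<in>UNIV. ?c h *\<^sub>R \<eta> h"
  let ?S = "\<Sum>v\<in>?V. Dzeta_at v (oct_e i)"
  have T\<omega>: "T (\<omega> h) = (\<Sum>j\<in>UNIV. of_int (n h j) *\<^sub>R \<omega> j)" for h
    unfolding T_def by (rule n)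
  \<comment> \<open>Weighting with the cofactors replaces the eight values at the periods by the
    single value at \<open>oct_e i\<close>, times the determinant.\<close>
  have "(\<Sum>h\<in>UNIV. ?c h *\<^sub>R (\<Sum>v\<in>?V. Dzeta_at v (\<omega> h))) =
      (\<Sum>v\<in>?V. Dzeta_at v (\<Sum>h\<in>UNIV. ?c h *\<^sub>R \<omega> h))"
    by (simp only: scaleR_sum_right linear_sum[OF linear_Dzeta_at] linear_scale[OF linear_Dzeta_at])
      (rule sum.swap)
  also have "\<dots> = ?d *\<^sub>R ?S"
    by (simp only: sum_cofactor_basis linear_scale[OF linear_Dzeta_at] scaleR_sum_right)
  finally have S: "(\<Sum>h\<in>UNIV. ?c h *\<^sub>R (\<Sum>v\<in>?V. Dzeta_at v (\<omega> h))) = ?d *\<^sub>R ?S" .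
  have "N ^ 3 *\<^sub>R ?A = (\<Sum>h\<in>UNIV. ?c h *\<^sub>R K (?x h))"
    by (simp add: K_def scaleR_sum_right mult.commute)
  also have "\<dots> = (\<Sum>h\<in>UNIV. N ^ 4 *\<^sub>R ?c h *\<^sub>R \<eta> h - ?c h *\<^sub>R (\<Sum>v\<in>?V. Dzeta_at v (\<omega> h)))"
    by (simp add: K_legendre[OF eta T\<omega>] scaleR_diff_right mult.commute)
  also have "\<dots> = N ^ 4 *\<^sub>R ?B - ?d *\<^sub>R ?S"
    by (simp only: sum_subtractf S) (simp only: scaleR_sum_right)
  finally have "?d *\<^sub>R ?S = - (N ^ 3 *\<^sub>R (?A - N *\<^sub>R ?B))"
    by (simp add: scaleR_diff_right power_numeral_reduce)
  \<comment> \<open>Independence of the periods makes the determinant nonzero, so it can be divided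
    out.\<close>
  then have "(1 / ?d) *\<^sub>R (?d *\<^sub>R ?S) = (1 / ?d) *\<^sub>R (- (N ^ 3 *\<^sub>R (?A - N *\<^sub>R ?B)))"
    by (rule arg_cong)
  then have "?S = - (N ^ 3 / ?d) *\<^sub>R (?A - N *\<^sub>R ?B)"
    using det_period_matrix_nonzero by simp
  then show ?thesis
    unfolding sum_wp\<tau>_eq N_def .
qed

end
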